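(* Let $f:(\mathbb{R}^2,(0,0))\to(\mathbb{R}^2,(0,0))$ be the germ of a real-analytic map having an elliptic fixed point at the origin with irrational rotation number $\omega_0\in(0,\tfrac12)$, and suppose that $f$ admits a real-analytic first integral $I_1:U\to\mathbb{R}$, in a neighbourhood $U$ of the origin, such that $I_1$ has a non-degenerate local minimum at $(0,0)$. Then $f$ admits no second first integral $I_2$ (either continuous, $C^\infty$-smooth, real-meromorphic with no pole at the origin, or real-analytic) which is functionally independent of $I_1$ on a non-empty and open subset of $U\setminus\{(0,0)\}$. The same conclusion holds even in the case where $f$ is additionally assumed to be symplectic.
   Context: A real-analytic planar map germ $f$ with $f(0,0)=(0,0)$ has an elliptic fixed point at the origin with rotation number $\omega_0\in(0,\tfrac12)$ if the eigenvalues of its linear part $L=d_{(0,0)}f$ are $\mu=e^{i2\pi\omega_0}$ and $\bar\mu$. The plane is identified with $\mathbb{C}$ via $z=x+iy$, and it is assumed that in this coordinate $L(z)=\mu z$. Symplectic means preserving $dx\wedge dy$. A first integral of $f$ is a function $I$ defined in a neighbourhood of the origin with $I\circ f=I$ near the origin (wherever both sides are defined, in the meromorphic case). A non-degenerate local minimum at $(0,0)$ means a critical point there with positive definite Hessian. A real-meromorphic function with no pole at the origin is a quotient $P/Q$ of real-analytic functions with $Q(0,0)\neq0$. Since $f$ is a germ, the neighbourhood $U$ is understood to be sufficiently small. Functional independence of $I_1,I_2$ on an open set $W$ means that their differentials are linearly independent at every point of $W$ (where both are defined); when $I_2$ is merely continuous it means that there is no non-empty open $W'\subseteq W$ and no function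 $H$ of one real variable with $I_2=H\circ I_1$ on $W'$. *)

theory Defs
  imports "HOL-Analysis.Analysis"
begin

text \<open>
  The plane is the type \<^typ>\<open>complex\<close>, regarded as a two-dimensional real space; all derivatives
  below are real Frechet derivatives.

  Real-analyticity is given by double power series in the real coordinates. The unordered
  convergence of \<^const>\<open>has_sum\<close> is absolute convergence here. The coefficients lie in the target
  space, so that the notion covers both scalar functions and planar maps.
\<close>

definition real_analytic_at :: "(complex \<Rightarrow> 'b::real_normed_vector) \<Rightarrow> complex \<Rightarrow> bool" where
  "real_analytic_at g p \<longleftrightarrow>
     (\<exists>(c :: nat \<Rightarrow> nat \<Rightarrow> 'b) r. r > 0 \<and>
        (\<forall>z\<in>ball p r.
           ((\<lambda>(i, j). (Re (z - p) ^ i * Im (z - p) ^ j) *\<^sub>R c i j) has_sum g z) UNIV))"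

definition real_analytic_on :: "(complex \<Rightarrow> 'b::real_normed_vector) \<Rightarrow> complex set \<Rightarrow> bool" where
  "real_analytic_on g U \<longleftrightarrow> (\<forall>p\<in>U. real_analytic_at g p)"

text \<open>\<open>C_on k g U\<close> and \<open>smooth_on g U\<close> are meant for open \<open>U\<close> only.\<close>

primrec C_on :: "nat \<Rightarrow> (complex \<Rightarrow> real) \<Rightarrow> complex set \<Rightarrow> bool" where
  "C_on 0 g U \<longleftrightarrow> continuous_on U g"
| "C_on (Suc k) g U \<longleftrightarrow>
     (\<forall>z\<in>U. g differentiable (at z)) \<and>
     (\<forall>v. C_on k (\<lambda>z. frechet_derivative g (at z) v) U)"

definition smooth_on :: "(complex \<Rightarrow> real) \<Rightarrow> complex set \<Rightarrow> bool" where
  "smooth_on g U \<longleftrightarrow> (\<forall>k. C_on k g U)"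

text \<open>
  The linear part is normalised to \<open>L z = \<mu> z\<close> with \<open>\<mu> = exp (2 \<pi> \<i> \<omega>)\<close>; as a real-linear map of
  the plane it has the eigenvalues \<open>\<mu>\<close> and \<open>cnj \<mu>\<close>.
\<close>

definition elliptic_fixed_point :: "(complex \<Rightarrow> complex) \<Rightarrow> real \<Rightarrow> bool" where
  "elliptic_fixed_point f \<omega> \<longleftrightarrow>
     f 0 = 0 \<and> 0 < \<omega> \<and> \<omega> < 1/2 \<and> (f has_derivative (\<lambda>z. cis (2 * pi * \<omega>) * z)) (at 0)"

definition area_form :: "complex \<Rightarrow> complex \<Rightarrow> real" where
  "area_form u v = Re u * Im v - Im u * Re v"

definition symplectic_on :: "complex set \<Rightarrow> (complex \<Rightarrow> complex) \<Rightarrow> bool" where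
  "symplectic_on U f \<longleftrightarrow>
     (\<forall>z\<in>U. f differentiable (at z) \<and>
        (\<forall>u v. area_form (frechet_derivative f (at z) u) (frechet_derivative f (at z) v)
               = area_form u v))"

definition hessian :: "(complex \<Rightarrow> real) \<Rightarrow> complex \<Rightarrow> complex \<Rightarrow> complex \<Rightarrow> real" where
  "hessian g p u v = frechet_derivative (\<lambda>z. frechet_derivative g (at z) u) (at p) v"

definition nondegenerate_local_min :: "(complex \<Rightarrow> real) \<Rightarrow> complex \<Rightarrow> bool" where
  "nondegenerate_local_min g p \<longleftrightarrow>
     (g has_derivative (\<lambda>v. 0)) (at p) \<and> (\<forall>v. v \<noteq> 0 \<longrightarrow> hessian g p v v > 0)"

text \<open>
  \<open>A\<close> is the domain of \<open>I\<close>; invariance is required exactly where both \<open>I z\<close> and \<open>I (f z)\<close> are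
  defined. The set \<open>A\<close> need not be invariant under \<open>f\<close>.
\<close>

definition first_integral_on ::
  "(complex \<Rightarrow> complex) \<Rightarrow> complex set \<Rightarrow> (complex \<Rightarrow> real) \<Rightarrow> bool" where
  "first_integral_on f A I \<longleftrightarrow> (\<forall>z\<in>A. f z \<in> A \<longrightarrow> I (f z) = I z)"

definition differentials_independent_on ::
  "(complex \<Rightarrow> real) \<Rightarrow> (complex \<Rightarrow> real) \<Rightarrow> complex set \<Rightarrow> bool" where
  "differentials_independent_on I\<^sub>1 I\<^sub>2 W \<longleftrightarrow>
     (\<forall>z\<in>W. \<forall>a b :: real.
        (\<forall>v. a * frechet_derivative I\<^sub>1 (at z) v + b * frechet_derivative I\<^sub>2 (at z) v = 0)
          \<longrightarrow> a = 0 \<and> b = 0)"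

definition continuously_independent_on ::
  "(complex \<Rightarrow> real) \<Rightarrow> (complex \<Rightarrow> real) \<Rightarrow> complex set \<Rightarrow> bool" where
  "continuously_independent_on I\<^sub>1 I\<^sub>2 W \<longleftrightarrow>
     \<not> (\<exists>W' (H :: real \<Rightarrow> real). open W' \<and> W' \<noteq> {} \<and> W' \<subseteq> W \<and> (\<forall>z\<in>W'. I\<^sub>2 z = H (I\<^sub>1 z)))"

text \<open>
  The four disjuncts are the four regularity classes of a second integral. A meromorphic integral
  is a pair \<open>P\<close>, \<open>Q\<close> whose domain is the set where \<open>Q\<close> does not vanish; poles in \<open>U\<close> away from the
  origin are allowed.
\<close>

definition has_independent_integral_on ::
  "(complex \<Rightarrow> complex) \<Rightarrow> (complex \<Rightarrow> real) \<Rightarrow> complex set \<Rightarrow> complex set \<Rightarrow> bool" where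
  "has_independent_integral_on f I\<^sub>1 U W \<longleftrightarrow>
     (\<exists>I\<^sub>2. continuous_on U I\<^sub>2 \<and> first_integral_on f U I\<^sub>2 \<and>
           continuously_independent_on I\<^sub>1 I\<^sub>2 W) \<or>
     (\<exists>I\<^sub>2. smooth_on I\<^sub>2 U \<and> first_integral_on f U I\<^sub>2 \<and>
           differentials_independent_on I\<^sub>1 I\<^sub>2 W) \<or>
     (\<exists>P Q. real_analytic_on P U \<and> real_analytic_on Q U \<and> Q 0 \<noteq> 0 \<and>
           first_integral_on f {z\<in>U. Q z \<noteq> 0} (\<lambda>z. P z / Q z) \<and>
           differentials_independent_on I\<^sub>1 (\<lambda>z. P z / Q z) {z\<in>W. Q z \<noteq> 0}) \<or>
     (\<exists>I\<^sub>2. real_analytic_on I\<^sub>2 U \<and> first_integral_on f U I\<^sub>2 \<and>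
           differentials_independent_on I\<^sub>1 I\<^sub>2 W)"

text \<open>
  The precise meaning of ``in a sufficiently small neighbourhood of the origin'': inside every
  neighbourhood \<open>V\<close> there is a neighbourhood \<open>U\<close>, chosen before the second integral and the set
  \<open>W\<close>, on which no independent second integral exists. This covers a second integral \<open>I\<^sub>2\<close> given as
  a germ (take for \<open>V\<close> a neighbourhood on which \<open>I\<^sub>2\<close> is defined and invariant). It cannot be asked
  of all small \<open>U\<close>: if \<open>U\<close> is a disc together with a small open set whose image and preimage
  miss \<open>U\<close>, then a first integral on \<open>U\<close> is arbitrary on that set.
\<close>

definition no_independent_integral_near_0 ::
  "(complex \<Rightarrow> complex) \<Rightarrow> (complex \<Rightarrow> real) \<Rightarrow> complex set \<Rightarrow> bool" where
  "no_independent_integral_near_0 f I\<^sub>1 U\<^sub>0 \<longleftrightarrow>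
     (\<forall>V. open V \<and> 0 \<in> V \<and> V \<subseteq> U\<^sub>0 \<longrightarrow>
        (\<exists>U. open U \<and> 0 \<in> U \<and> U \<subseteq> V \<and>
           \<not> (\<exists>W. open W \<and> W \<noteq> {} \<and> W \<subseteq> U - {0} \<and> has_independent_integral_on f I\<^sub>1 U W)))"

end

theory Submission
  imports Defs "HOL-Complex_Analysis.Complex_Analysis"
begin

text \<open>
  Near the origin \<open>I\<close> is strictly increasing along rays, so its levels are closed curves, invariant
  under \<open>f\<close> and analytic by the implicit function theorem, and \<open>f\<close> acts on each of them as a circle
  homeomorphism. A continuous invariant function of a circle homeomorphism is constant as soon as, for
  every period, the set of periodic points is countable. Without periodic points, a gap of the
  set where the function is maximal is a wandering interval, some iterate of which is shorter than
  any given length. With periodic points, all values are already taken at the countably many fixed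
  points of an iterate, and a countable connected set of reals has at most one point.

  By analyticity, the points of a level fixed by \<open>f ^^ q\<close> are countable in number or fill the
  level. In the second case the point of the level on the positive real axis is fixed by
  \<open>f ^^ q\<close>. This happens for countably many levels only, since otherwise \<open>f ^^ q\<close> would be
  the identity on the axis, hence \<open>\<mu> ^ q = 1\<close>, contrary to the irrationality of the rotation
  number. By continuity across the levels, every continuous first integral is constant on all
  levels. For a meromorphic integral this holds near the origin, and the vanishing of
  the wedge of the two differentials propagates along rays by analyticity.
\<close>

section \<open>Double power series and real-analytic functions\<close>

text \<open>Levels on which an iterate of \<open>f\<close> is the identity do occur: for the twist z
  -> z exp(2 pi i (\<omega> + |z|^2)) every circle with rational rotation number is one, and
  invariance does not force a continuous \<open>h\<close> to be constant there. Only the other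
  levels decide, so the exceptional ones must be few and the behaviour of \<open>h\<close> on them
  is recovered as a limit. Counting them needs no theory of planar analytic sets: the fixed points
  of \<open>f ^^ q\<close> are only examined along one level and along the real axis, where they are
  zeros of functions of one real variable with holomorphic extensions. The axis is useful because it
  passes through the origin, the one point where the linear part of \<open>f\<close> is prescribed.
  A meromorphic integral need not be continuous beyond its first poles, so the argument by levels
  stops there; the numerator of its derivative has no poles and can be followed further.\<close>

definition double_series :: "(nat \<Rightarrow> nat \<Rightarrow> complex) \<Rightarrow> complex \<Rightarrow> complex \<Rightarrow> complex" where
  "double_series c x y = (\<Sum>\<^sub>\<infinity>(i, j)\<in>UNIV. c i j * x ^ i * y ^ j)"

text \<open>Absolute summability at the corner point (\<rho>, \<rho>) dominates every term on the
  closed bidisc of radius \<rho>, so one real number controls convergence in both complex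
  variables.\<close>

definition double_series_conv :: "(nat \<Rightarrow> nat \<Rightarrow> complex) \<Rightarrow> real \<Rightarrow> bool" where
  "double_series_conv c \<rho> \<longleftrightarrow> \<rho> > 0 \<and> (\<lambda>(i, j). norm (c i j) * \<rho> ^ (i + j)) summable_on UNIV"

definition coeff_dx :: "(nat \<Rightarrow> nat \<Rightarrow> complex) \<Rightarrow> nat \<Rightarrow> nat \<Rightarrow> complex" where
  "coeff_dx c i j = of_nat (Suc i) * c (Suc i) j"

definition coeff_dy :: "(nat \<Rightarrow> nat \<Rightarrow> complex) \<Rightarrow> nat \<Rightarrow> nat \<Rightarrow> complex" where
  "coeff_dy c i j = of_nat (Suc j) * c i (Suc j)"

lemma double_series_term_bound:
  fixes x y :: complex
  assumes "norm x \<le> \<rho>" "norm y \<le> \<rho>"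
  shows "norm (c i j * x ^ i * y ^ j) \<le> norm (c i j) * \<rho> ^ (i + j)"
proof -
  have "0 \<le> \<rho>" using assms(1) norm_ge_zero[of x] by linarith
  then have "norm x ^ i * norm y ^ j \<le> \<rho> ^ i * \<rho> ^ j"
    using assms by (intro mult_mono power_mono) auto
  then have "norm (c i j) * (norm x ^ i * norm y ^ j) \<le> norm (c i j) * (\<rho> ^ i * \<rho> ^ j)"
    by (rule mult_left_mono) simp
  then show ?thesis
    by (simp add: norm_mult norm_power power_add mult.assoc)
qed

lemma double_series_has_sum:
  assumes "double_series_conv c \<rho>" "norm x \<le> \<rho>" "norm y \<le> \<rho>"
  shows "((\<lambda>(i, j). c i j * x ^ i * y ^ j) has_sum double_series c x y) UNIV"
  unfolding double_series_def
proof (rule has_sum_infsum)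
  have "(\<lambda>z. norm (case z of (i, j) \<Rightarrow> c i j * x ^ i * y ^ j)) summable_on UNIV"
    by (rule summable_on_comparison_test[where f = "\<lambda>(i, j). norm (c i j) * \<rho> ^ (i + j)"])
       (use assms double_series_term_bound[OF assms(2,3)] in \<open>auto simp: double_series_conv_def split: prod.splits\<close>)
  then show "(\<lambda>(i, j). c i j * x ^ i * y ^ j) summable_on UNIV"
    by (rule abs_summable_summable)
qed

lemma double_series_uniform_limit:
  assumes "double_series_conv c \<rho>"
  shows "uniform_limit (cball 0 \<rho> \<times> cball 0 \<rho>)
           (\<lambda>S w. \<Sum>(i, j)\<in>S. c i j * fst w ^ i * snd w ^ j) (\<lambda>w. double_series c (fst w) (snd w))
           (finite_subsets_at_top UNIV)"
proof -
  have "uniform_limit (cball 0 \<rho> \<times> cball 0 \<rho>)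
          (\<lambda>S w. \<Sum>z\<in>S. (case z of (i, j) \<Rightarrow> c i j * fst w ^ i * snd w ^ j)) (\<lambda>w. double_series c (fst w) (snd w))
          (finite_subsets_at_top UNIV)"
    by (rule Weierstrass_m_test_general'[where M = "\<lambda>(i, j). norm (c i j) * \<rho> ^ (i + j)"])
       (use assms double_series_term_bound double_series_has_sum[OF assms] in
        \<open>auto simp: double_series_conv_def split: prod.splits\<close>)
  then show ?thesis by simp
qed

lemma double_series_continuous_on:
  assumes "double_series_conv c \<rho>"
  shows "continuous_on (cball 0 \<rho> \<times> cball 0 \<rho>) (\<lambda>w. double_series c (fst w) (snd w))"
  by (rule uniform_limit_theorem[OF _ double_series_uniform_limit[OF assms]])
     (auto intro!: always_eventually continuous_intros simp: split_def)

lemma double_series_conv_swap: "double_series_conv c \<rho> \<Longrightarrow> double_series_conv (\<lambda>i j. c j i) \<rho>"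
  unfolding double_series_conv_def
  using summable_on_reindex_bij_betw[of prod.swap UNIV UNIV "\<lambda>(i, j). norm (c i j) * \<rho> ^ (i + j)"]
  by (auto simp: split_def add.commute)

lemma double_series_swap: "double_series (\<lambda>i j. c j i) y x = double_series c x y"
  unfolding double_series_def
  using infsum_reindex_bij_betw[of prod.swap UNIV UNIV "\<lambda>(i, j). c i j * x ^ i * y ^ j"]
  by (auto simp: split_def mult_ac)

text \<open>The factor \<open>Suc i\<close> produced by differentiation is absorbed by a power of
  \<open>\<rho>' / \<rho>\<close>, since n q^n is bounded for 0 < q < 1; this is what costs radius.
  The constant \<open>B / \<rho>'\<close> includes the price of the index shift.\<close>

lemma double_series_conv_coeff_dx:
  assumes "double_series_conv c \<rho>" "0 < \<rho>'" "\<rho>' < \<rho>"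
  shows "double_series_conv (coeff_dx c) \<rho>'"
proof -
  define q where "q = \<rho>' / \<rho>"
  have q: "0 < q" "q < 1" using assms by (auto simp: q_def)
  have "(\<lambda>n. real n * q ^ n) \<longlonglongrightarrow> 0"
    using powser_times_n_limit_0[of q] q by simp
  then have "Bseq (\<lambda>n. real n * q ^ n)" by (rule convergent_imp_Bseq[OF convergentI])
  then obtain B where B: "\<And>n. \<bar>real n * q ^ n\<bar> \<le> B" by (auto simp: Bseq_def)
  have le: "norm (coeff_dx c i j) * \<rho>' ^ (i + j) \<le> B / \<rho>' * (norm (c (Suc i) j) * \<rho> ^ (Suc i + j))" for i j
  proof -
    have "real (Suc i) * \<rho>' ^ Suc i \<le> B * \<rho> ^ Suc i"
      using B[of "Suc i"] assms q by (auto simp: q_def field_simps power_divide)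
    moreover have "\<rho>' ^ j \<le> \<rho> ^ j" using assms by (intro power_mono) auto
    ultimately have "(real (Suc i) * \<rho>' ^ Suc i) * \<rho>' ^ j \<le> (B * \<rho> ^ Suc i) * \<rho> ^ j"
      by (rule mult_mono) (use assms B[of 0] in auto)
    then have "norm (c (Suc i) j) * ((real (Suc i) * \<rho>' ^ Suc i) * \<rho>' ^ j)
        \<le> norm (c (Suc i) j) * ((B * \<rho> ^ Suc i) * \<rho> ^ j)"
      by (intro mult_left_mono) auto
    moreover have "norm (coeff_dx c i j) * \<rho>' ^ (i + j)
        = norm (c (Suc i) j) * ((real (Suc i) * \<rho>' ^ Suc i) * \<rho>' ^ j) / \<rho>'"
      using assms by (simp add: coeff_dx_def norm_mult power_add del: of_nat_Suc)
    moreover have "B / \<rho>' * (norm (c (Suc i) j) * \<rho> ^ (Suc i + j))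
        = norm (c (Suc i) j) * ((B * \<rho> ^ Suc i) * \<rho> ^ j) / \<rho>'"
      by (simp add: power_add)
    ultimately show ?thesis using assms by (simp only: divide_right_mono)
  qed
  have "(\<lambda>(i, j). norm (c i j) * \<rho> ^ (i + j)) summable_on (\<lambda>(i, j). (Suc i, j)) ` UNIV"
    using assms by (auto simp: double_series_conv_def intro: summable_on_subset_banach)
  then have "(\<lambda>(i, j). norm (c (Suc i) j) * \<rho> ^ (Suc i + j)) summable_on UNIV"
    by (subst (asm) summable_on_reindex) (auto simp: inj_on_def o_def split_def)
  then have "(\<lambda>z. B / \<rho>' * (case z of (i, j) \<Rightarrow> norm (c (Suc i) j) * \<rho> ^ (Suc i + j))) summable_on UNIV"
    by (rule summable_on_cmult_right)
  then have "(\<lambda>(i, j). norm (coeff_dx c i j) * \<rho>' ^ (i + j)) summable_on UNIV"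
  proof (rule summable_on_comparison_test)
    show "(case z of (i, j) \<Rightarrow> norm (coeff_dx c i j) * \<rho>' ^ (i + j))
        \<le> B / \<rho>' * (case z of (i, j) \<Rightarrow> norm (c (Suc i) j) * \<rho> ^ (Suc i + j))" for z
      by (cases z) (simp only: prod.case le)
    show "0 \<le> (case z of (i, j) \<Rightarrow> norm (coeff_dx c i j) * \<rho>' ^ (i + j))" for z
      using \<open>0 < \<rho>'\<close> by (cases z) simp
  qed
  then show ?thesis using assms by (simp add: double_series_conv_def)
qed

lemma coeff_dy_eq: "coeff_dy c = (\<lambda>i j. coeff_dx (\<lambda>i j. c j i) j i)"
  by (intro ext) (simp add: coeff_dx_def coeff_dy_def)

lemma double_series_conv_coeff_dy: "double_series_conv c \<rho> \<Longrightarrow> 0 < \<rho>' \<Longrightarrow> \<rho>' < \<rho> \<Longrightarrow> double_series_conv (coeff_dy c) \<rho>'"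
  unfolding coeff_dy_eq by (rule double_series_conv_swap[OF double_series_conv_coeff_dx[OF double_series_conv_swap]])

text \<open>The finite partial sums are polynomials in \<open>x\<close> converging uniformly on a
  disc, so their derivatives converge to the derivative of the limit. Uniqueness of limits
  identifies it with the formally differentiated series.\<close>

lemma double_series_has_field_derivative_x:
  assumes c: "double_series_conv c \<rho>" and x: "norm x < \<rho>" and y: "norm y < \<rho>"
  shows "((\<lambda>x. double_series c x y) has_field_derivative double_series (coeff_dx c) x y) (at x)"
proof -
  define F where "F = finite_subsets_at_top (UNIV :: (nat \<times> nat) set)"
  define f where "f = (\<lambda>S x. \<Sum>(i, j)\<in>S. c i j * x ^ i * y ^ j)"
  define f' where "f' = (\<lambda>S x. \<Sum>(i, j)\<in>S. c i j * (of_nat i * x ^ (i - 1)) * y ^ j)"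
  have "\<rho> > 0" using c by (simp add: double_series_conv_def)
  have f: "((\<lambda>x. f S x) has_field_derivative f' S x) (at x)" for S x
    unfolding f_def f'_def split_def
    by (rule derivative_eq_intros refl sum.cong | simp)+
  then have 1: "\<forall>\<^sub>F S in F. continuous_on (cball 0 \<rho>) (f S)
      \<and> (\<forall>w\<in>ball 0 \<rho>. (f S has_field_derivative f' S w) (at w))"
    by (intro always_eventually allI conjI ballI continuous_at_imp_continuous_on DERIV_isCont[OF f] f)
  have "uniform_limit (cball 0 \<rho>) (\<lambda>S x. \<Sum>(i, j)\<in>S. c i j * fst (x, y) ^ i * snd (x, y) ^ j)
          (\<lambda>x. double_series c (fst (x, y)) (snd (x, y))) F"
    unfolding F_def
    by (rule uniform_limit_compose'[OF double_series_uniform_limit[OF c]]) (use y in auto)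
  then have 2: "uniform_limit (cball 0 \<rho>) f (\<lambda>x. double_series c x y) F" by (simp add: f_def)
  obtain g' where g': "\<And>w. w \<in> ball 0 \<rho> \<Longrightarrow>
      ((\<lambda>x. double_series c x y) has_field_derivative g' w) (at w) \<and> ((\<lambda>S. f' S w) \<longlongrightarrow> g' w) F"
    by (rule has_complex_derivative_uniform_limit[OF 1 2]) (use \<open>\<rho> > 0\<close> in \<open>auto simp: F_def\<close>)
  \<comment> \<open>An intermediate radius is needed because the differentiated series is known to
    converge only on strictly smaller bidiscs.\<close>
  obtain \<rho>' where \<rho>': "0 < \<rho>'" "\<rho>' < \<rho>" "norm x \<le> \<rho>'" "norm y \<le> \<rho>'"
  proof -
    obtain \<rho>' where "max (norm x) (norm y) < \<rho>'" "\<rho>' < \<rho>" using dense[of "max (norm x) (norm y)" \<rho>] x y by auto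
    then show ?thesis using norm_ge_zero[of x] that[of \<rho>'] by (auto simp del: norm_ge_zero)
  qed
  have inj: "inj (\<lambda>(i, j). (Suc i, j))" by (auto simp: inj_on_def)
  have "((\<lambda>(i, j). coeff_dx c i j * x ^ i * y ^ j) has_sum double_series (coeff_dx c) x y) UNIV"
    by (rule double_series_has_sum[OF double_series_conv_coeff_dx[OF c \<rho>'(1,2)] \<rho>'(3,4)])
  then have "(((\<lambda>(i, j). c i j * (of_nat i * x ^ (i - 1)) * y ^ j) \<circ> (\<lambda>(i, j). (Suc i, j))) has_sum double_series (coeff_dx c) x y) UNIV"
    by (simp add: o_def split_def coeff_dx_def mult_ac del: of_nat_Suc)
  then have "((\<lambda>(i, j). c i j * (of_nat i * x ^ (i - 1)) * y ^ j) has_sum double_series (coeff_dx c) x y)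
      ((\<lambda>(i, j). (Suc i, j)) ` UNIV)"
    by (subst has_sum_reindex[OF inj])
  \<comment> \<open>The shifted index set omits the pairs with \<open>i = 0\<close>; their terms
    vanish through the factor \<open>of_nat i\<close>, so the truncated exponent
    \<open>i - 1\<close> does no harm.\<close>
  also have "?this \<longleftrightarrow> ((\<lambda>(i, j). c i j * (of_nat i * x ^ (i - 1)) * y ^ j) has_sum double_series (coeff_dx c) x y) UNIV"
  proof (rule has_sum_cong_neutral)
    fix z assume "z \<in> UNIV - (\<lambda>(i::nat, j::nat). (Suc i, j)) ` UNIV"
    moreover obtain i j where "z = (i, j)" by (cases z)
    ultimately have "z = (0, j)" by (cases i) (auto simp: image_iff)
    then show "(case z of (i, j) \<Rightarrow> c i j * (of_nat i * x ^ (i - 1)) * y ^ j) = 0" by simp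
  qed auto
  finally have "((\<lambda>S. f' S x) \<longlongrightarrow> double_series (coeff_dx c) x y) F"
    by (simp add: has_sum_def F_def f'_def)
  moreover have "((\<lambda>S. f' S x) \<longlongrightarrow> g' x) F" using g'[of x] x by simp
  ultimately have "g' x = double_series (coeff_dx c) x y" using tendsto_unique[of F] by (auto simp: F_def)
  then show ?thesis using g'[of x] x by simp
qed

lemma double_series_has_field_derivative_y:
  assumes "double_series_conv c \<rho>" "norm x < \<rho>" "norm y < \<rho>"
  shows "((\<lambda>y. double_series c x y) has_field_derivative double_series (coeff_dy c) x y) (at y)"
proof -
  have "((\<lambda>y. double_series (\<lambda>i j. c j i) y x) has_field_derivative double_series (coeff_dx (\<lambda>i j. c j i)) y x) (at y)"
    by (rule double_series_has_field_derivative_x[OF double_series_conv_swap]) (use assms in auto)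
  moreover have "double_series (coeff_dx (\<lambda>i j. c j i)) y x = double_series (coeff_dy c) x y"
    unfolding coeff_dy_eq by (rule double_series_swap[symmetric])
  ultimately show ?thesis by (simp add: double_series_swap[of c])
qed

text \<open>Convergence is asked for on all smaller radii instead of at \<rho> itself, so that the
  lemma applies to \<open>coeff_dx c\<close> and \<open>coeff_dy c\<close>.\<close>

lemma double_series_isCont:
  assumes c: "\<And>\<rho>'. 0 < \<rho>' \<Longrightarrow> \<rho>' < \<rho> \<Longrightarrow> double_series_conv c \<rho>'" and x: "norm x < \<rho>" and y: "norm y < \<rho>"
  shows "isCont (\<lambda>w. double_series c (fst w) (snd w)) (x, y)"
proof -
  obtain \<rho>' where \<rho>': "0 < \<rho>'" "\<rho>' < \<rho>" "norm x < \<rho>'" "norm y < \<rho>'"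
  proof -
    obtain \<rho>' where "max (norm x) (norm y) < \<rho>'" "\<rho>' < \<rho>" using dense[of "max (norm x) (norm y)" \<rho>] x y by auto
    then show ?thesis using norm_ge_zero[of x] that[of \<rho>'] by (auto simp del: norm_ge_zero)
  qed
  have "continuous_on (ball 0 \<rho>' \<times> ball 0 \<rho>') (\<lambda>w. double_series c (fst w) (snd w))"
    by (rule continuous_on_subset[OF double_series_continuous_on[OF c[OF \<rho>'(1,2)]]]) auto
  then show ?thesis
    by (rule continuous_on_interior) (use \<rho>' in \<open>auto simp: interior_Times\<close>)
qed

text \<open>Partial derivatives in each variable, with joint continuity of the second one, give
  total differentiability. The derivative is complex linear, so holomorphic functions may be
  substituted for both variables.\<close>

lemma double_series_has_derivative:
  assumes c: "double_series_conv c \<rho>" and x: "norm x < \<rho>" and y: "norm y < \<rho>"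
  shows "((\<lambda>w. double_series c (fst w) (snd w)) has_derivative
           (\<lambda>u. double_series (coeff_dx c) x y * fst u + double_series (coeff_dy c) x y * snd u)) (at (x, y))"
proof -
  have "((\<lambda>(x, y). double_series c x y) has_derivative
          (\<lambda>(tx, ty). double_series (coeff_dx c) x y * tx + blinfun_apply (blinfun_mult_right (double_series (coeff_dy c) x y)) ty))
        (at (x, y) within ball 0 \<rho> \<times> ball 0 \<rho>)"
  proof (rule has_derivative_partialsI)
    show "((\<lambda>x. double_series c x y) has_derivative (*) (double_series (coeff_dx c) x y)) (at x within ball 0 \<rho>)"
      using double_series_has_field_derivative_x[OF c x y]
      by (simp add: has_field_derivative_def has_derivative_at_withinI)
    show "((\<lambda>y. double_series c x y) has_derivative blinfun_apply (blinfun_mult_right (double_series (coeff_dy c) x y))) (at y within ball 0 \<rho>)"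
      if "x \<in> ball 0 \<rho>" "y \<in> ball 0 \<rho>" for x y
      using double_series_has_field_derivative_y[OF c, of x y] that
      by (simp add: has_field_derivative_def has_derivative_at_withinI)
    have "isCont (\<lambda>w. double_series (coeff_dy c) (fst w) (snd w)) (x, y)"
      using double_series_isCont[OF double_series_conv_coeff_dy[OF c] x y] by simp
    then have "isCont (\<lambda>w. blinfun_mult_right (double_series (coeff_dy c) (fst w) (snd w))) (x, y)"
      by (rule bounded_linear.isCont[OF bounded_linear_blinfun_mult_right])
    then show "continuous (at (x, y) within ball 0 \<rho> \<times> ball 0 \<rho>) (\<lambda>(x, y). blinfun_mult_right (double_series (coeff_dy c) x y))"
      by (simp add: split_def continuous_at_imp_continuous_at_within)
  qed (use y in auto)
  moreover have "at (x, y) within ball 0 \<rho> \<times> ball 0 \<rho> = at (x, y)"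
    by (rule at_within_open) (use x y in \<open>auto intro: open_Times\<close>)
  ultimately show ?thesis by (simp add: split_def)
qed

lemma double_series_has_field_derivative_compose:
  assumes "double_series_conv c \<rho>" "norm (a s) < \<rho>" "norm (b s) < \<rho>"
    and "(a has_field_derivative a') (at s)" "(b has_field_derivative b') (at s)"
  shows "((\<lambda>s. double_series c (a s) (b s)) has_field_derivative
           (double_series (coeff_dx c) (a s) (b s) * a' + double_series (coeff_dy c) (a s) (b s) * b')) (at s)"
proof -
  have "((\<lambda>s. (a s, b s)) has_derivative (\<lambda>h. (a' * h, b' * h))) (at s)"
    using assms(4,5) by (auto simp: has_field_derivative_def intro!: has_derivative_Pair)
  then have "((\<lambda>s. double_series c (fst (a s, b s)) (snd (a s, b s))) has_derivative
      (\<lambda>h. double_series (coeff_dx c) (a s) (b s) * fst (a' * h, b' * h) + double_series (coeff_dy c) (a s) (b s) * snd (a' * h, b' * h))) (at s)"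
    by (rule has_derivative_compose[where g = "\<lambda>w. double_series c (fst w) (snd w)"])
       (rule double_series_has_derivative[OF assms(1-3)])
  then show ?thesis
    unfolding has_field_derivative_def
    by (simp, elim has_derivative_eq_rhs) (auto simp: fun_eq_iff algebra_simps)
qed

section \<open>Real-analytic functions as restrictions of complex double series\<close>

lemma real_analytic_at_double_series:
  fixes g :: "complex \<Rightarrow> complex"
  assumes "real_analytic_at g p"
  obtains c \<rho> where "double_series_conv c \<rho>"
    "\<And>z. \<bar>Re (z - p)\<bar> < \<rho> \<Longrightarrow> \<bar>Im (z - p)\<bar> < \<rho> \<Longrightarrow> g z = double_series c (of_real (Re (z - p))) (of_real (Im (z - p)))"
proof -
  obtain c r where r: "r > 0" and sum: "\<And>z. z \<in> ball p r \<Longrightarrow>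
      ((\<lambda>(i, j). (Re (z - p) ^ i * Im (z - p) ^ j) *\<^sub>R c i j) has_sum g z) UNIV"
    using assms unfolding real_analytic_at_def by blast
  \<comment> \<open>A third of the radius: points of the closed square have norm at most
    \<open>2 * \<rho>\<close>, which is less than \<open>r\<close>, so even the corner lies in the
    ball.\<close>
  define \<rho> where "\<rho> = r / 3"
  have "\<rho> > 0" using r by (simp add: \<rho>_def)
  have in_ball: "z \<in> ball p r" if "\<bar>Re (z - p)\<bar> \<le> \<rho>" "\<bar>Im (z - p)\<bar> \<le> \<rho>" for z
    using cmod_le[of "z - p"] that r by (simp add: \<rho>_def dist_norm norm_minus_commute)
  \<comment> \<open>Convergence at the corner suffices: for complex families unordered summability
    is absolute summability, which is what \<open>double_series_conv\<close> requires.\<close>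
  have "(\<lambda>(i, j). (\<rho> ^ i * \<rho> ^ j) *\<^sub>R c i j) summable_on UNIV"
    using sum[OF in_ball, of "p + Complex \<rho> \<rho>"] \<open>\<rho> > 0\<close> by (auto intro: has_sum_imp_summable)
  then have "(\<lambda>z. norm (case z of (i, j) \<Rightarrow> (\<rho> ^ i * \<rho> ^ j) *\<^sub>R c i j)) summable_on UNIV"
    by (rule summable_on_iff_abs_summable_on_complex[THEN iffD1])
  then have "double_series_conv c \<rho>"
    using \<open>\<rho> > 0\<close> by (simp add: double_series_conv_def split_def power_add mult_ac)
  moreover have "g z = double_series c (of_real (Re (z - p))) (of_real (Im (z - p)))"
    if "\<bar>Re (z - p)\<bar> < \<rho>" "\<bar>Im (z - p)\<bar> < \<rho>" for z
    using sum[OF in_ball, of z, THEN infsumI] that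
    by (simp add: double_series_def scaleR_conv_of_real mult_ac)
  ultimately show ?thesis using that by blast
qed

lemma real_analytic_at_of_double_series:
  fixes g :: "complex \<Rightarrow> complex"
  assumes "double_series_conv c \<rho>"
    and "\<And>z. \<bar>Re (z - p)\<bar> < \<rho> \<Longrightarrow> \<bar>Im (z - p)\<bar> < \<rho> \<Longrightarrow> g z = double_series c (of_real (Re (z - p))) (of_real (Im (z - p)))"
  shows "real_analytic_at g p"
  unfolding real_analytic_at_def
proof (intro exI conjI ballI)
  show "\<rho> > 0" using assms by (simp add: double_series_conv_def)
  fix z assume "z \<in> ball p \<rho>"
  then have z: "\<bar>Re (z - p)\<bar> < \<rho>" "\<bar>Im (z - p)\<bar> < \<rho>"
    using abs_Re_le_cmod[of "z - p"] abs_Im_le_cmod[of "z - p"]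
    by (auto simp: dist_norm norm_minus_commute simp del: minus_complex.sel)
  have "((\<lambda>(i, j). c i j * of_real (Re (z - p)) ^ i * of_real (Im (z - p)) ^ j) has_sum g z) UNIV"
    unfolding assms(2)[OF z] by (rule double_series_has_sum[OF assms(1)]; unfold norm_of_real; use z in linarith)
  then show "((\<lambda>(i, j). (Re (z - p) ^ i * Im (z - p) ^ j) *\<^sub>R c i j) has_sum g z) UNIV"
    by (simp add: scaleR_conv_of_real mult_ac)
qed

lemma real_analytic_at_partials_complex:
  fixes g :: "complex \<Rightarrow> complex"
  assumes "real_analytic_at g p"
  obtains gx gy r where "r > 0" "real_analytic_at gx p" "real_analytic_at gy p"
    "\<And>z. z \<in> ball p r \<Longrightarrow> (g has_derivative (\<lambda>v. of_real (Re v) * gx z + of_real (Im v) * gy z)) (at z)"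
proof -
  obtain c \<rho> where c: "double_series_conv c \<rho>" and g: "\<And>z. \<bar>Re (z - p)\<bar> < \<rho> \<Longrightarrow> \<bar>Im (z - p)\<bar> < \<rho> \<Longrightarrow>
      g z = double_series c (of_real (Re (z - p))) (of_real (Im (z - p)))"
    using real_analytic_at_double_series[OF assms] by blast
  have "\<rho> > 0" using c by (simp add: double_series_conv_def)
  define P where "P c z = double_series c (of_real (Re (z - p))) (of_real (Im (z - p)))" for c z
  \<comment> \<open>Differentiation costs radius, so analyticity of the partials is certified on
    radius \<open>\<rho> / 2\<close>; the formula for the derivative below still holds on the whole
    ball of radius \<rho>.\<close>
  have "real_analytic_at (P (coeff_dx c)) p" "real_analytic_at (P (coeff_dy c)) p"
    by (rule real_analytic_at_of_double_series[OF double_series_conv_coeff_dx[OF c, of "\<rho> / 2"]]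
             real_analytic_at_of_double_series[OF double_series_conv_coeff_dy[OF c, of "\<rho> / 2"]];
        use \<open>\<rho> > 0\<close> in \<open>simp add: P_def\<close>)+
  moreover have "(g has_derivative (\<lambda>v. of_real (Re v) * P (coeff_dx c) z + of_real (Im v) * P (coeff_dy c) z)) (at z)"
    if "z \<in> ball p \<rho>" for z
  proof -
    have small: "\<bar>Re (w - p)\<bar> < \<rho>" "\<bar>Im (w - p)\<bar> < \<rho>" if "w \<in> ball p \<rho>" for w
      using abs_Re_le_cmod[of "w - p"] abs_Im_le_cmod[of "w - p"] that
      by (auto simp: dist_norm norm_minus_commute simp del: minus_complex.sel)
    have "((\<lambda>z. (of_real (Re (z - p)) :: complex, of_real (Im (z - p)) :: complex)) has_derivative
        (\<lambda>v. (of_real (Re v), of_real (Im v)))) (at z)"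
      by (auto intro!: derivative_eq_intros)
    then have "((\<lambda>z. double_series c (fst (of_real (Re (z - p)) :: complex, of_real (Im (z - p)) :: complex))
            (snd (of_real (Re (z - p)) :: complex, of_real (Im (z - p)) :: complex))) has_derivative
        (\<lambda>v. double_series (coeff_dx c) (of_real (Re (z - p))) (of_real (Im (z - p))) * fst (complex_of_real (Re v), complex_of_real (Im v))
           + double_series (coeff_dy c) (of_real (Re (z - p))) (of_real (Im (z - p))) * snd (complex_of_real (Re v), complex_of_real (Im v)))) (at z)"
      by (rule has_derivative_compose[where g = "\<lambda>w. double_series c (fst w) (snd w)"])
         (rule double_series_has_derivative[OF c]; unfold norm_of_real; rule small[OF that])
    then have "(P c has_derivative (\<lambda>v. of_real (Re v) * P (coeff_dx c) z + of_real (Im v) * P (coeff_dy c) z)) (at z)"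
      by (simp add: P_def[abs_def] mult.commute)
    then show ?thesis
      by (rule has_derivative_transform_within_open[of _ _ _ _ "ball p \<rho>"])
         (use that in \<open>auto simp: P_def g[OF small]\<close>)
  qed
  ultimately show ?thesis using that \<open>\<rho> > 0\<close> by blast
qed

lemma real_analytic_at_isCont_complex:
  fixes g :: "complex \<Rightarrow> complex"
  assumes "real_analytic_at g p"
  shows "isCont g p"
  using assms
proof (rule real_analytic_at_partials_complex)
  fix gx gy r
  assume "0 < (r::real)" "\<And>z. z \<in> ball p r \<Longrightarrow>
    (g has_derivative (\<lambda>v. of_real (Re v) * gx z + of_real (Im v) * gy z)) (at z)"
  then have "(g has_derivative (\<lambda>v. of_real (Re v) * gx p + of_real (Im v) * gy p)) (at p)" by simp
  then show ?thesis by (rule has_derivative_continuous)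
qed

lemma real_analytic_at_of_real:
  assumes "real_analytic_at g p"
  shows "real_analytic_at (\<lambda>z. complex_of_real (g z)) p"
proof -
  obtain c r where r: "r > 0" and sum: "\<And>z. z \<in> ball p r \<Longrightarrow>
      ((\<lambda>(i, j). (Re (z - p) ^ i * Im (z - p) ^ j) *\<^sub>R c i j) has_sum g z) UNIV"
    using assms unfolding real_analytic_at_def by blast
  show ?thesis unfolding real_analytic_at_def
  proof (intro exI[of _ "\<lambda>i j. complex_of_real (c i j)"] exI[of _ r] conjI ballI r)
    fix z assume "z \<in> ball p r"
    from has_sum_of_real[OF sum[OF this], where 'a = complex]
    show "((\<lambda>(i, j). (Re (z - p) ^ i * Im (z - p) ^ j) *\<^sub>R complex_of_real (c i j)) has_sum of_real (g z)) UNIV"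
      by (simp add: split_def scaleR_conv_of_real)
  qed
qed

lemma real_analytic_at_Re:
  assumes "real_analytic_at g p"
  shows "real_analytic_at (\<lambda>z. Re (g z)) p"
proof -
  obtain c r where r: "r > 0" and sum: "\<And>z. z \<in> ball p r \<Longrightarrow>
      ((\<lambda>(i, j). (Re (z - p) ^ i * Im (z - p) ^ j) *\<^sub>R c i j) has_sum g z) UNIV"
    using assms unfolding real_analytic_at_def by blast
  show ?thesis unfolding real_analytic_at_def
  proof (intro exI[of _ "\<lambda>i j. Re (c i j)"] exI[of _ r] conjI ballI r)
    fix z assume "z \<in> ball p r"
    from has_sum_Re[OF sum[OF this]]
    show "((\<lambda>(i, j). (Re (z - p) ^ i * Im (z - p) ^ j) *\<^sub>R Re (c i j)) has_sum Re (g z)) UNIV"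
      by (simp add: split_def)
  qed
qed

lemma real_analytic_at_partials:
  fixes g :: "complex \<Rightarrow> real"
  assumes "real_analytic_at g p"
  obtains gx gy r where "r > 0" "real_analytic_at gx p" "real_analytic_at gy p"
    "\<And>z. z \<in> ball p r \<Longrightarrow> (g has_derivative (\<lambda>v. Re v * gx z + Im v * gy z)) (at z)"
proof -
  obtain gx gy r where *: "r > 0" "real_analytic_at gx p" "real_analytic_at gy p"
    and der: "\<And>z. z \<in> ball p r \<Longrightarrow>
      ((\<lambda>z. complex_of_real (g z)) has_derivative (\<lambda>v. of_real (Re v) * gx z + of_real (Im v) * gy z)) (at z)"
    by (rule real_analytic_at_partials_complex[OF real_analytic_at_of_real[OF assms]]) (rule that)
  have "(g has_derivative (\<lambda>v. Re v * Re (gx z) + Im v * Re (gy z))) (at z)" if "z \<in> ball p r" for z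
    using bounded_linear.has_derivative[OF bounded_linear_Re der[OF that]] by simp
  then show ?thesis
    by (rule that[OF *(1) real_analytic_at_Re[OF *(2)] real_analytic_at_Re[OF *(3)]])
qed

section \<open>Curves with a holomorphic extension\<close>

text \<open>Real-analyticity of a planar curve, encoded by an extension to a complex disc so that
  the identity theorem in one complex variable applies. Off the real axis the real and imaginary
  parts of \<Phi> have no meaning for the curve.\<close>

definition analytic_curve :: "(real \<Rightarrow> complex) \<Rightarrow> real \<Rightarrow> bool" where
  "analytic_curve \<phi> t \<longleftrightarrow> (\<exists>\<epsilon>>0. \<exists>\<Phi>. \<Phi> holomorphic_on ball (of_real t) \<epsilon> \<and>
     (\<forall>x. \<bar>x - t\<bar> < \<epsilon> \<longrightarrow> \<Phi> (of_real x) = \<phi> x))"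

lemma of_real_in_ball [simp]: "complex_of_real x \<in> ball (of_real t) \<epsilon> \<longleftrightarrow> \<bar>x - t\<bar> < \<epsilon>"
  by (simp add: dist_norm norm_minus_commute abs_minus_commute flip: of_real_diff)

lemma analytic_curve_combine:
  assumes "analytic_curve \<phi> t" "analytic_curve \<psi> t"
    and "\<And>S \<Phi> \<Psi>. \<Phi> holomorphic_on S \<Longrightarrow> \<Psi> holomorphic_on S \<Longrightarrow> (\<lambda>s. H (\<Phi> s) (\<Psi> s)) holomorphic_on S"
  shows "analytic_curve (\<lambda>x. H (\<phi> x) (\<psi> x)) t"
proof -
  obtain e1 \<Phi> where 1: "e1 > 0" "\<Phi> holomorphic_on ball (of_real t) e1" "\<And>x. \<bar>x - t\<bar> < e1 \<Longrightarrow> \<Phi> (of_real x) = \<phi> x"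
    using assms(1) unfolding analytic_curve_def by blast
  obtain e2 \<Psi> where 2: "e2 > 0" "\<Psi> holomorphic_on ball (of_real t) e2" "\<And>x. \<bar>x - t\<bar> < e2 \<Longrightarrow> \<Psi> (of_real x) = \<psi> x"
    using assms(2) unfolding analytic_curve_def by blast
  have "(\<lambda>s. H (\<Phi> s) (\<Psi> s)) holomorphic_on ball (of_real t) (min e1 e2)"
    using 1(2) 2(2) by (intro assms(3)) (auto intro: holomorphic_on_subset)
  then show ?thesis
    unfolding analytic_curve_def using 1 2
    by (intro exI[of _ "min e1 e2"] conjI exI[of _ "\<lambda>s. H (\<Phi> s) (\<Psi> s)"]) auto
qed

lemma analytic_curve_add: "analytic_curve \<phi> t \<Longrightarrow> analytic_curve \<psi> t \<Longrightarrow> analytic_curve (\<lambda>x. \<phi> x + \<psi> x) t"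
  by (rule analytic_curve_combine) (auto intro: holomorphic_intros)

lemma analytic_curve_diff: "analytic_curve \<phi> t \<Longrightarrow> analytic_curve \<psi> t \<Longrightarrow> analytic_curve (\<lambda>x. \<phi> x - \<psi> x) t"
  by (rule analytic_curve_combine) (auto intro: holomorphic_intros)

lemma analytic_curve_mult: "analytic_curve \<phi> t \<Longrightarrow> analytic_curve \<psi> t \<Longrightarrow> analytic_curve (\<lambda>x. \<phi> x * \<psi> x) t"
  by (rule analytic_curve_combine) (auto intro: holomorphic_intros)

lemma analytic_curve_of_entire: "\<Phi> holomorphic_on UNIV \<Longrightarrow> analytic_curve (\<lambda>x. \<Phi> (of_real x)) t"
  unfolding analytic_curve_def by (rule exI[of _ 1]) (auto intro: holomorphic_on_subset)

lemma analytic_curve_const: "analytic_curve (\<lambda>x. a) t"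
  using analytic_curve_of_entire[of "\<lambda>_. a"] by simp

lemma analytic_curve_of_real: "analytic_curve of_real t"
  using analytic_curve_of_entire[of "\<lambda>z. z"] by simp

text \<open>Schwarz reflection: conjugating before and after keeps the extension holomorphic and
  leaves the real parameter alone. This makes the two real coordinates of a curve extend
  holomorphically one by one.\<close>

lemma analytic_curve_cnj:
  assumes "analytic_curve \<phi> t"
  shows "analytic_curve (\<lambda>x. cnj (\<phi> x)) t"
proof -
  obtain e \<Phi> where 1: "e > 0" "\<Phi> holomorphic_on ball (of_real t) e" "\<And>x. \<bar>x - t\<bar> < e \<Longrightarrow> \<Phi> (of_real x) = \<phi> x"
    using assms unfolding analytic_curve_def by blast
  have "cnj ` ball (of_real t) e = ball (of_real t) e"
    by (simp add: image_cnj_conv_vimage_cnj vimage_def dist_norm ball_def)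
       (metis (no_types, opaque_lifting) complex_cnj_complex_of_real complex_cnj_diff complex_mod_cnj)
  then have "cnj \<circ> \<Phi> \<circ> cnj holomorphic_on ball (of_real t) e"
    using 1(2) by (intro holomorphic_on_compose_cnj_cnj) auto
  then show ?thesis
    unfolding analytic_curve_def using 1 by (intro exI[of _ e] conjI exI[of _ "cnj \<circ> \<Phi> \<circ> cnj"]) auto
qed

lemma analytic_curve_Re:
  assumes "analytic_curve \<phi> t"
  shows "analytic_curve (\<lambda>x. of_real (Re (\<phi> x))) t"
proof -
  have "analytic_curve (\<lambda>x. (1 / 2) * (\<phi> x + cnj (\<phi> x))) t"
    by (intro analytic_curve_mult analytic_curve_add analytic_curve_const analytic_curve_cnj assms)
  then show ?thesis by (simp add: complex_add_cnj)
qed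

lemma analytic_curve_Im:
  assumes "analytic_curve \<phi> t"
  shows "analytic_curve (\<lambda>x. of_real (Im (\<phi> x))) t"
proof -
  have "analytic_curve (\<lambda>x. of_real (Re (- \<i> * \<phi> x))) t"
    by (intro analytic_curve_mult analytic_curve_Re analytic_curve_const assms)
  then show ?thesis by simp
qed

text \<open>\<open>g\<close> itself is not assumed holomorphic. What extends to complex arguments is
  its double series in the two real coordinates, and the extensions \<open>A\<close> and
  \<open>B\<close> of the coordinates of the curve are substituted into it.\<close>

lemma analytic_curve_compose:
  assumes g: "real_analytic_at g (z t)" and z: "analytic_curve z t"
  shows "analytic_curve (\<lambda>x. g (z x)) t"
proof -
  define p where "p = z t"
  obtain c \<rho> where c: "double_series_conv c \<rho>" and g_series: "\<And>w. \<bar>Re (w - p)\<bar> < \<rho> \<Longrightarrow> \<bar>Im (w - p)\<bar> < \<rho> \<Longrightarrow>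
      g w = double_series c (of_real (Re (w - p))) (of_real (Im (w - p)))"
    using real_analytic_at_double_series[OF g] unfolding p_def by blast
  have "\<rho> > 0" using c by (simp add: double_series_conv_def)
  have zp: "analytic_curve (\<lambda>x. z x - p) t" by (intro analytic_curve_diff z analytic_curve_const)
  obtain e1 A where A: "e1 > 0" "A holomorphic_on ball (of_real t) e1"
      "\<And>x. \<bar>x - t\<bar> < e1 \<Longrightarrow> A (of_real x) = of_real (Re (z x - p))"
    using analytic_curve_Re[OF zp] unfolding analytic_curve_def by blast
  obtain e2 B where B: "e2 > 0" "B holomorphic_on ball (of_real t) e2"
      "\<And>x. \<bar>x - t\<bar> < e2 \<Longrightarrow> B (of_real x) = of_real (Im (z x - p))"
    using analytic_curve_Im[OF zp] unfolding analytic_curve_def by blast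
  have "isCont A (of_real t)" "isCont B (of_real t)"
    using A B by (auto intro!: holomorphic_on_imp_continuous_on continuous_on_interior simp: continuous_on_interior)
  moreover have "A (of_real t) = 0" "B (of_real t) = 0" using A(3)[of t] B(3)[of t] A(1) B(1) by (auto simp: p_def)
  ultimately obtain d1 d2 where d: "d1 > 0" "d2 > 0" "\<And>s. dist s (of_real t) < d1 \<Longrightarrow> norm (A s) < \<rho>"
      "\<And>s. dist s (of_real t) < d2 \<Longrightarrow> norm (B s) < \<rho>"
    using \<open>\<rho> > 0\<close> unfolding continuous_at_eps_delta by (metis dist_0_norm dist_commute)
  \<comment> \<open>The disc has to lie in the domains of \<open>A\<close> and \<open>B\<close> and
    to be mapped by both into the disc of radius \<rho>; both vanish at its centre.\<close>
  define \<epsilon> where "\<epsilon> = Min {e1, e2, d1, d2}"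
  have \<epsilon>: "\<epsilon> > 0" "\<epsilon> \<le> e1" "\<epsilon> \<le> e2" "\<epsilon> \<le> d1" "\<epsilon> \<le> d2" using A B d by (auto simp: \<epsilon>_def)
  have small: "norm (A s) < \<rho>" "norm (B s) < \<rho>" if "s \<in> ball (of_real t) \<epsilon>" for s
    using d(3,4)[of s] \<epsilon> that by (auto simp: dist_commute)
  have "(\<lambda>s. double_series c (A s) (B s)) holomorphic_on ball (of_real t) \<epsilon>"
  proof (rule holomorphic_onI)
    fix s assume s: "s \<in> ball (complex_of_real t) \<epsilon>"
    then have "A field_differentiable (at s)" "B field_differentiable (at s)"
      using A(2) B(2) \<epsilon> by (auto simp: holomorphic_on_open field_differentiable_def)
    then obtain a' b' where "(A has_field_derivative a') (at s)" "(B has_field_derivative b') (at s)"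
      by (auto simp: field_differentiable_def)
    from double_series_has_field_derivative_compose[OF c small[OF s] this]
    show "(\<lambda>s. double_series c (A s) (B s)) field_differentiable at s within ball (of_real t) \<epsilon>"
      using field_differentiable_at_within field_differentiable_def by blast
  qed
  moreover have "double_series c (A (of_real x)) (B (of_real x)) = g (z x)" if "\<bar>x - t\<bar> < \<epsilon>" for x
  proof -
    have AB: "A (of_real x) = of_real (Re (z x - p))" "B (of_real x) = of_real (Im (z x - p))"
      using A(3) B(3) \<epsilon> that by auto
    then have "\<bar>Re (z x - p)\<bar> < \<rho>" "\<bar>Im (z x - p)\<bar> < \<rho>"
      using small[of "of_real x"] that
      by (auto simp: dist_real_def abs_minus_commute simp del: minus_complex.sel)
    then show ?thesis using g_series[of "z x"] AB by simp
  qed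
  ultimately show ?thesis unfolding analytic_curve_def using \<epsilon>(1) by blast
qed

lemma analytic_curve_has_vector_derivative:
  assumes "analytic_curve \<phi> t"
  obtains d where "(\<phi> has_vector_derivative d) (at t)"
proof -
  obtain e \<Phi> where 1: "e > 0" "\<Phi> holomorphic_on ball (of_real t) e" "\<And>x. \<bar>x - t\<bar> < e \<Longrightarrow> \<Phi> (of_real x) = \<phi> x"
    using assms unfolding analytic_curve_def by blast
  then obtain d where "(\<Phi> has_field_derivative d) (at (of_real t))"
    by (metis centre_in_ball holomorphic_on_open open_ball)
  then have "((\<lambda>x. \<Phi> (of_real x)) has_vector_derivative d) (at t)"
    by (rule has_vector_derivative_real_field)
  then have "(\<phi> has_vector_derivative d) (at t)"
    by (rule has_vector_derivative_transform_within_open[of _ _ _ "ball t e"])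
       (use 1 in \<open>auto simp: dist_real_def abs_minus_commute\<close>)
  then show ?thesis by (rule that)
qed

lemma analytic_curve_zero_near_limit_point:
  assumes "analytic_curve \<phi> t" "t islimpt {x. \<phi> x = 0}"
  obtains e where "e > 0" "\<And>x. \<bar>x - t\<bar> < e \<Longrightarrow> \<phi> x = 0"
proof -
  obtain e \<Phi> where 1: "e > 0" "\<Phi> holomorphic_on ball (of_real t) e" "\<And>x. \<bar>x - t\<bar> < e \<Longrightarrow> \<Phi> (of_real x) = \<phi> x"
    using assms(1) unfolding analytic_curve_def by blast
  define U where "U = complex_of_real ` {x. \<bar>x - t\<bar> < e \<and> \<phi> x = 0}"
  have "of_real t islimpt U"
    unfolding islimpt_approachable
  proof (intro allI impI)
    fix d :: real assume "d > 0"
    then obtain x where "\<phi> x = 0" "x \<noteq> t" "dist x t < min d e"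
      using assms(2)[unfolded islimpt_approachable, rule_format, of "min d e"] \<open>e > 0\<close> by auto
    then show "\<exists>x'\<in>U. x' \<noteq> of_real t \<and> dist x' (of_real t) < d"
      by (intro bexI[of _ "of_real x"]) (auto simp: U_def dist_real_def)
  qed
  moreover have "U \<subseteq> ball (of_real t) e" by (auto simp: U_def dist_real_def abs_minus_commute)
  moreover have "\<Phi> z = 0" if "z \<in> U" for z using that 1(3) by (auto simp: U_def)
  ultimately have "\<Phi> w = 0" if "w \<in> ball (of_real t) e" for w
    using analytic_continuation[OF 1(2), of U "of_real t" w] 1(1) that by auto
  then have "\<phi> x = 0" if "\<bar>x - t\<bar> < e" for x using 1(3)[OF that] that by (metis of_real_in_ball)
  then show ?thesis using that 1(1) by blast
qed

text \<open>The accumulation points of zeros form an open subset of \<open>S\<close> by the identity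
  theorem, and a relatively closed one in any case. If there were none, the zeros would be discrete
  in \<open>S\<close>, hence countable.\<close>

lemma analytic_curve_zeros:
  assumes an: "\<And>t. t \<in> S \<Longrightarrow> analytic_curve \<phi> t" and S: "open S" "connected S"
    and unc: "uncountable {t \<in> S. \<phi> t = 0}" and "t \<in> S"
  shows "\<phi> t = 0"
proof -
  define N where "N = {t \<in> S. t islimpt {x. \<phi> x = 0}}"
  have "open N"
    unfolding open_contains_ball
  proof
    fix t assume "t \<in> N"
    then have t: "t \<in> S" "t islimpt {x. \<phi> x = 0}" by (auto simp: N_def)
    obtain e where e: "e > 0" "\<And>x. \<bar>x - t\<bar> < e \<Longrightarrow> \<phi> x = 0"
      using analytic_curve_zero_near_limit_point[OF an[OF t(1)] t(2)] by blast
    obtain d where d: "d > 0" "ball t d \<subseteq> S" using S(1) t(1) openE by blast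
    have "ball t (min d e) \<subseteq> N"
    proof
      fix x assume x: "x \<in> ball t (min d e)"
      have "x islimpt ball t (min d e)"
        using x by (intro open_imp_islimpt) auto
      then have "x islimpt {x. \<phi> x = 0}"
        by (rule islimpt_subset) (use e in \<open>auto simp: dist_real_def abs_minus_commute\<close>)
      then show "x \<in> N" using x d by (auto simp: N_def)
    qed
    then show "\<exists>e>0. ball t e \<subseteq> N" using d e by (metis min_less_iff_conj)
  qed
  moreover have "S - N = S \<inter> - {t. t islimpt {x. \<phi> x = 0}}" by (auto simp: N_def)
  then have "open (S - N)" using S(1) closed_limpts by (auto simp: open_Int)
  moreover have "N \<noteq> {}"
  proof
    assume "N = {}"
    then have "{x. \<phi> x = 0} sparse_in S" using S(1) by (auto simp: sparse_in_open N_def)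
    then have "countable (S \<inter> {x. \<phi> x = 0})" using S(1) by (intro sparse_imp_countable)
    then show False using unc by (simp add: Int_def)
  qed
  ultimately have "S - N = {}"
    using connectedD[OF S(2), of N "S - N"] by (auto simp: N_def)
  with \<open>t \<in> S\<close> have "t islimpt {x. \<phi> x = 0}" by (auto simp: N_def)
  from analytic_curve_zero_near_limit_point[OF an[OF \<open>t \<in> S\<close>] this] show ?thesis by force
qed

section \<open>Analyticity of polar level curves\<close>

lemma double_series_partials_continuous_on:
  assumes "double_series_conv c \<rho>"
  shows "continuous_on (ball 0 \<rho> \<times> ball 0 \<rho>) (\<lambda>w. double_series (coeff_dx c) (fst w) (snd w))"
    and "continuous_on (ball 0 \<rho> \<times> ball 0 \<rho>) (\<lambda>w. double_series (coeff_dy c) (fst w) (snd w))"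
  using double_series_isCont[OF double_series_conv_coeff_dx[OF assms]] double_series_isCont[OF double_series_conv_coeff_dy[OF assms]]
  by (auto intro!: continuous_at_imp_continuous_on)

text \<open>The inverse function theorem for real derivatives, applied to the map sending (x, y) to
  (x, E (x, y)), yields the branch; complex linearity of the derivative makes it holomorphic. Only
  uniqueness of the solution is recorded, because the function to be compared with \<tau> is given
  beforehand.\<close>

lemma implicit_holomorphic:
  fixes E Ea Eb :: "complex \<times> complex \<Rightarrow> complex"
  assumes N: "open N" "(a, b) \<in> N"
    and der: "\<And>w. w \<in> N \<Longrightarrow> (E has_derivative (\<lambda>u. Ea w * fst u + Eb w * snd u)) (at w)"
    and cont: "continuous_on N Ea" "continuous_on N Eb"
    and nz: "Eb (a, b) \<noteq> 0"
  obtains \<epsilon> \<delta> \<tau> where "\<epsilon> > 0" "\<delta> > 0" "\<tau> holomorphic_on ball a \<epsilon>"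
    "\<And>x y. x \<in> ball a \<epsilon> \<Longrightarrow> y \<in> ball b \<delta> \<Longrightarrow> E (x, y) = E (a, b) \<Longrightarrow> y = \<tau> x"
proof -
  define \<Phi> where "\<Phi> w = (fst w, E w)" for w
  define D where "D w = Blinfun (\<lambda>u. (fst u, Ea w * fst u + Eb w * snd u))" for w
  have D: "blinfun_apply (D w) = (\<lambda>u. (fst u, Ea w * fst u + Eb w * snd u))" for w
    unfolding D_def
    by (rule bounded_linear_Blinfun_apply)
       (intro bounded_linear_Pair bounded_linear_fst bounded_linear_add bounded_linear_snd
          bounded_linear_const_mult)
  have der\<Phi>: "(\<Phi> has_derivative blinfun_apply (D w)) (at w)" if "w \<in> N" for w
    unfolding \<Phi>_def[abs_def] D by (intro has_derivative_Pair der that derivative_intros)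
  have contD: "continuous_on N D"
    by (intro continuous_on_blinfun_componentwise) (auto simp: D intro!: continuous_intros cont)
  \<comment> \<open>The inverse of a triangular complex matrix with diagonal entries 1 and
    \<open>Eb (a, b)\<close>.\<close>
  define inv0 where "inv0 = Blinfun (\<lambda>u. (fst u, (1 / Eb (a, b)) * (snd u - Ea (a, b) * fst u)))"
  have "blinfun_apply inv0 = (\<lambda>u. (fst u, (1 / Eb (a, b)) * (snd u - Ea (a, b) * fst u)))"
    unfolding inv0_def
    by (rule bounded_linear_Blinfun_apply)
       (intro bounded_linear_Pair bounded_linear_fst bounded_linear_sub bounded_linear_snd
          bounded_linear_const_mult)
  then have "inv0 o\<^sub>L D (a, b) = id_blinfun"
    using nz by (intro blinfun_eqI) (auto simp: D)
  note inv0 = this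
  obtain U' V g g' where g: "open U'" "U' \<subseteq> N" "(a, b) \<in> U'" "open V" "\<Phi> (a, b) \<in> V"
      "homeomorphism U' V \<Phi> g"
      "\<And>y. y \<in> V \<Longrightarrow> (g has_derivative (g' y)) (at y)"
      "\<And>y. y \<in> V \<Longrightarrow> g' y = inv (blinfun_apply (D (g y)))"
      "\<And>y. y \<in> V \<Longrightarrow> bij (blinfun_apply (D (g y)))"
    by (rule inverse_function_theorem[OF N(1) der\<Phi> contD N(2) inv0]) (assumption, rule that)
  define \<tau> where "\<tau> x = snd (g (x, E (a, b)))" for x
  obtain A B where AB: "open A" "open B" "a \<in> A" "b \<in> B" "A \<times> B \<subseteq> U'"
    using open_prod_elim[OF g(1,3)] by (metis mem_Sigma_iff)
  have V': "open ((\<lambda>x. (x, E (a, b))) -` V)"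
    by (intro open_vimage g(4) continuous_intros)
  then have "open (A \<inter> (\<lambda>x. (x, E (a, b))) -` V)" using AB by blast
  moreover have "a \<in> A \<inter> (\<lambda>x. (x, E (a, b))) -` V" using AB g(5) by (simp add: \<Phi>_def)
  ultimately obtain \<epsilon> where \<epsilon>: "\<epsilon> > 0" "ball a \<epsilon> \<subseteq> A \<inter> (\<lambda>x. (x, E (a, b))) -` V"
    using openE by blast
  obtain \<delta> where \<delta>: "\<delta> > 0" "ball b \<delta> \<subseteq> B" using AB openE by blast
  have "y = \<tau> x" if "x \<in> ball a \<epsilon>" "y \<in> ball b \<delta>" "E (x, y) = E (a, b)" for x y
  proof -
    have "(x, y) \<in> U'" using that \<epsilon> \<delta> AB by blast
    then have "g (\<Phi> (x, y)) = (x, y)" using g(6) by (auto simp: homeomorphism_def)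
    then show ?thesis using that by (simp add: \<Phi>_def \<tau>_def)
  qed
  moreover have "\<tau> holomorphic_on ball a \<epsilon>"
  proof (rule holomorphic_onI)
    fix x assume "x \<in> ball a \<epsilon>"
    then have xV: "(x, E (a, b)) \<in> V" using \<epsilon> by auto
    define w where "w = g (x, E (a, b))"
    define T where "T = g' (x, E (a, b))"
    have bij: "bij (blinfun_apply (D w))" using g(9)[OF xV] by (simp add: w_def)
    have DT: "blinfun_apply (D w) (T u) = u" for u
      using g(8)[OF xV] bij by (simp add: w_def T_def bij_is_surj surj_f_inv_f)
    \<comment> \<open>Bijectivity of the derivative over all of \<open>V\<close> makes
      \<open>Eb\<close> nonzero along the whole branch, not only at the base point.\<close>
    have "Eb w \<noteq> 0"
    proof
      assume "Eb w = 0"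
      then have "blinfun_apply (D w) (0, 1) = blinfun_apply (D w) (0, 0)" by (simp add: D)
      then show False using bij_is_inj[OF bij] by (metis injD prod.inject zero_neq_one)
    qed
    \<comment> \<open>Implicit differentiation: \<open>T (h, 0)\<close> is the tangent to the
      solution set whose first component is \<open>h\<close>.\<close>
    then have "snd (T (h, 0)) = - (Ea w / Eb w) * h" for h
      using DT[of "(h, 0)"] by (auto simp: D field_simps eq_neg_iff_add_eq_0)
    moreover have "((\<lambda>x. (x, E (a, b))) has_derivative (\<lambda>h. (h, 0))) (at x)"
      by (auto intro!: derivative_eq_intros)
    then have "((\<lambda>x. g (x, E (a, b))) has_derivative (\<lambda>h. T (h, 0))) (at x)"
      unfolding T_def by (rule has_derivative_compose) (rule g(7)[OF xV])
    then have "(\<tau> has_derivative (\<lambda>h. snd (T (h, 0)))) (at x)"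
      unfolding \<tau>_def[abs_def] by (rule has_derivative_snd)
    ultimately have "(\<tau> has_derivative (*) (- (Ea w / Eb w))) (at x)"
      by (elim has_derivative_eq_rhs) (simp add: fun_eq_iff)
    then have "(\<tau> has_field_derivative - (Ea w / Eb w)) (at x)"
      by (simp add: has_field_derivative_def)
    then show "\<tau> field_differentiable at x within ball a \<epsilon>"
      using field_differentiable_at_within field_differentiable_def by blast
  qed
  ultimately show ?thesis using that \<epsilon> \<delta> by blast
qed

text \<open>The equation of the level is complexified in the angle and the radius together, with
  \<open>cis\<close> replaced by the entire cosine and sine. The nonzero radial derivative makes it
  solvable for the radius, and continuity of \<open>r\<close> ensures that the given radius is the
  solution found.\<close>

lemma polar_level_set_analytic:
  fixes I :: "complex \<Rightarrow> real" and r :: "real \<Rightarrow> real"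
  assumes an: "real_analytic_at I (of_real (r \<theta>0) * cis (2 * pi * \<theta>0))"
    and cont: "isCont r \<theta>0"
    and level: "\<And>\<theta>. I (of_real (r \<theta>) * cis (2 * pi * \<theta>)) = c"
    and der: "((\<lambda>t. I (of_real t * cis (2 * pi * \<theta>0))) has_real_derivative d) (at (r \<theta>0))" "d \<noteq> 0"
  shows "analytic_curve (\<lambda>\<theta>. of_real (r \<theta>)) \<theta>0"
proof -
  define p where "p = of_real (r \<theta>0) * cis (2 * pi * \<theta>0)"
  obtain k \<rho> where k: "double_series_conv k \<rho>" and I_series: "\<And>z. \<bar>Re (z - p)\<bar> < \<rho> \<Longrightarrow> \<bar>Im (z - p)\<bar> < \<rho> \<Longrightarrow>
      of_real (I z) = double_series k (of_real (Re (z - p))) (of_real (Im (z - p)))"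
    using real_analytic_at_double_series[OF real_analytic_at_of_real[OF an]] unfolding p_def by blast
  have "\<rho> > 0" using k by (simp add: double_series_conv_def)
  \<comment> \<open>Cartesian coordinates relative to \<open>p\<close>, as functions of a complex
    angle \<open>fst w\<close> and a complex radius \<open>snd w\<close>.\<close>
  define X Y :: "complex \<times> complex \<Rightarrow> complex" where
    "X w = snd w * cos (of_real (2 * pi) * fst w) - of_real (Re p)" and
    "Y w = snd w * sin (of_real (2 * pi) * fst w) - of_real (Im p)" for w
  define E where "E w = double_series k (X w) (Y w)" for w
  define Ea where "Ea w = double_series (coeff_dx k) (X w) (Y w) * (- of_real (2 * pi) * snd w * sin (of_real (2 * pi) * fst w))
    + double_series (coeff_dy k) (X w) (Y w) * (of_real (2 * pi) * snd w * cos (of_real (2 * pi) * fst w))" for w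
  define Eb where "Eb w = double_series (coeff_dx k) (X w) (Y w) * cos (of_real (2 * pi) * fst w)
    + double_series (coeff_dy k) (X w) (Y w) * sin (of_real (2 * pi) * fst w)" for w
  define N where "N = (\<lambda>w. (X w, Y w)) -` (ball 0 \<rho> \<times> ball 0 \<rho>)"
  have contXY: "continuous_on S (\<lambda>w. (X w, Y w))" for S
    unfolding X_def Y_def by (intro continuous_intros)
  have "open N" unfolding N_def by (intro open_vimage contXY open_Times open_ball)
  have N: "norm (X w) < \<rho>" "norm (Y w) < \<rho>" if "w \<in> N" for w using that by (auto simp: N_def)
  have real: "X (of_real \<theta>, of_real t) = of_real (Re (of_real t * cis (2 * pi * \<theta>) - p))"
    "Y (of_real \<theta>, of_real t) = of_real (Im (of_real t * cis (2 * pi * \<theta>) - p))" for \<theta> t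
    unfolding X_def Y_def fst_conv snd_conv
    by (simp_all add: cos_of_real sin_of_real flip: of_real_mult)
  have Ereal: "E (of_real \<theta>, of_real t) = of_real (I (of_real t * cis (2 * pi * \<theta>)))"
    if "(of_real \<theta>, of_real t) \<in> N" for \<theta> t
    unfolding E_def using N[OF that] by (subst I_series) (simp_all only: real norm_of_real)
  have base: "(of_real \<theta>0, of_real (r \<theta>0)) \<in> N"
    using \<open>\<rho> > 0\<close> unfolding N_def vimage_def mem_Collect_eq real by (simp add: p_def)
  have derE: "(E has_derivative (\<lambda>u. Ea w * fst u + Eb w * snd u)) (at w)" if "w \<in> N" for w
  proof -
    have lin: "((\<lambda>w. of_real (2 * pi) * fst w) has_derivative (\<lambda>u. of_real (2 * pi) * fst u)) (at w)"
      by (intro derivative_intros)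
    note trig = has_derivative_compose[OF lin DERIV_cos[unfolded has_field_derivative_def]]
      has_derivative_compose[OF lin DERIV_sin[unfolded has_field_derivative_def]]
    have dX: "(X has_derivative (\<lambda>u. (- of_real (2 * pi) * snd w * sin (of_real (2 * pi) * fst w)) * fst u
        + cos (of_real (2 * pi) * fst w) * snd u)) (at w)"
      unfolding X_def[abs_def] 
      by (rule has_derivative_eq_rhs, (rule derivative_intros trig)+) (simp add: fun_eq_iff algebra_simps)
    have dY: "(Y has_derivative (\<lambda>u. (of_real (2 * pi) * snd w * cos (of_real (2 * pi) * fst w)) * fst u
        + sin (of_real (2 * pi) * fst w) * snd u)) (at w)"
      unfolding Y_def[abs_def] 
      by (rule has_derivative_eq_rhs, (rule derivative_intros trig)+) (simp add: fun_eq_iff algebra_simps)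
    have "((\<lambda>w. double_series k (fst (X w, Y w)) (snd (X w, Y w))) has_derivative
        (\<lambda>u. double_series (coeff_dx k) (X w) (Y w) * fst
            ((- of_real (2 * pi) * snd w * sin (of_real (2 * pi) * fst w)) * fst u
              + cos (of_real (2 * pi) * fst w) * snd u,
             (of_real (2 * pi) * snd w * cos (of_real (2 * pi) * fst w)) * fst u
              + sin (of_real (2 * pi) * fst w) * snd u)
          + double_series (coeff_dy k) (X w) (Y w) * snd
            ((- of_real (2 * pi) * snd w * sin (of_real (2 * pi) * fst w)) * fst u
              + cos (of_real (2 * pi) * fst w) * snd u,
             (of_real (2 * pi) * snd w * cos (of_real (2 * pi) * fst w)) * fst u
              + sin (of_real (2 * pi) * fst w) * snd u))) (at w)"
      by (rule has_derivative_compose[where g = "\<lambda>w. double_series k (fst w) (snd w)", OF has_derivative_Pair[OF dX dY]])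
         (rule double_series_has_derivative[OF k N[OF that]])
    then show ?thesis unfolding E_def[abs_def] Ea_def Eb_def fst_conv snd_conv
      by (rule has_derivative_eq_rhs) (simp add: fun_eq_iff algebra_simps)
  qed
  have "continuous_on N (\<lambda>w. double_series (coeff_dx k) (fst (X w, Y w)) (snd (X w, Y w)))"
    "continuous_on N (\<lambda>w. double_series (coeff_dy k) (fst (X w, Y w)) (snd (X w, Y w)))"
    by (rule continuous_on_compose2[OF double_series_partials_continuous_on(1)[OF k] contXY]
             continuous_on_compose2[OF double_series_partials_continuous_on(2)[OF k] contXY]; auto simp: N_def)+
  then have contE: "continuous_on N Ea" "continuous_on N Eb"
    unfolding Ea_def[abs_def] Eb_def[abs_def] by (auto intro!: continuous_intros)
  \<comment> \<open>On real arguments \<open>E\<close> is \<open>I\<close> in polar coordinates, so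
    a vanishing complex derivative in the radius would make the real radial derivative
    \<open>d\<close> vanish.\<close>
  have nz: "Eb (of_real \<theta>0, of_real (r \<theta>0)) \<noteq> 0"
  proof
    assume 0: "Eb (of_real \<theta>0, of_real (r \<theta>0)) = 0"
    have "((\<lambda>t. (of_real \<theta>0 :: complex, t)) has_derivative (\<lambda>h. (0, h))) (at (of_real (r \<theta>0)))"
      by (auto intro!: derivative_eq_intros)
    then have "((\<lambda>t. E (of_real \<theta>0, t)) has_derivative (\<lambda>h. Ea (of_real \<theta>0, of_real (r \<theta>0)) * fst (0 :: complex, h)
        + Eb (of_real \<theta>0, of_real (r \<theta>0)) * snd (0 :: complex, h))) (at (of_real (r \<theta>0)))"
      by (rule has_derivative_compose) (rule derE[OF base])
    then have "((\<lambda>t. E (of_real \<theta>0, t)) has_field_derivative 0) (at (of_real (r \<theta>0)))"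
      unfolding has_field_derivative_def by (rule has_derivative_eq_rhs) (simp add: fun_eq_iff 0)
    then have 1: "((\<lambda>t. E (of_real \<theta>0, of_real t)) has_vector_derivative 0) (at (r \<theta>0))"
      by (rule has_vector_derivative_real_field)
    have "open ((\<lambda>t. (complex_of_real \<theta>0, complex_of_real t)) -` N)"
      by (intro open_vimage \<open>open N\<close> continuous_intros)
    then have "((\<lambda>t. complex_of_real (I (of_real t * cis (2 * pi * \<theta>0)))) has_vector_derivative 0) (at (r \<theta>0))"
      by (rule has_vector_derivative_transform_within_open[OF 1]) (use base Ereal in auto)
    moreover have "((\<lambda>t. complex_of_real (I (of_real t * cis (2 * pi * \<theta>0)))) has_vector_derivative of_real d) (at (r \<theta>0))"
      using der(1) by (rule has_vector_derivative_of_real)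
    ultimately show False using der(2) vector_derivative_unique_at by fastforce
  qed
  obtain \<epsilon> \<delta> \<tau> where \<tau>: "\<epsilon> > 0" "\<delta> > 0" "\<tau> holomorphic_on ball (of_real \<theta>0) \<epsilon>"
    "\<And>x y. x \<in> ball (of_real \<theta>0) \<epsilon> \<Longrightarrow> y \<in> ball (of_real (r \<theta>0)) \<delta> \<Longrightarrow>
       E (x, y) = E (of_real \<theta>0, of_real (r \<theta>0)) \<Longrightarrow> y = \<tau> x"
    using implicit_holomorphic[OF \<open>open N\<close> base derE contE nz] by blast
  have "isCont (\<lambda>\<theta>. (complex_of_real \<theta>, complex_of_real (r \<theta>))) \<theta>0"
    using cont by (intro continuous_intros)
  moreover have "open (N \<inter> UNIV \<times> ball (of_real (r \<theta>0)) \<delta>)"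
    by (intro open_Int \<open>open N\<close> open_Times) auto
  \<comment> \<open>For angles near \<theta>0 the given radius stays in the disc in which \<tau> is
    the only solution.\<close>
  ultimately have "\<forall>\<^sub>F \<theta> in nhds \<theta>0. (complex_of_real \<theta>, complex_of_real (r \<theta>)) \<in> N \<inter> UNIV \<times> ball (of_real (r \<theta>0)) \<delta>"
    by (rule topological_tendstoD[OF isCont_def[THEN iffD1, unfolded tendsto_at_iff_tendsto_nhds]])
       (use base \<tau>(2) in auto)
  then obtain e where e: "e > 0" "\<And>\<theta>. dist \<theta> \<theta>0 < e \<Longrightarrow>
      (complex_of_real \<theta>, complex_of_real (r \<theta>)) \<in> N \<inter> UNIV \<times> ball (of_real (r \<theta>0)) \<delta>"
    unfolding eventually_nhds_metric by blast
  have "\<tau> (of_real \<theta>) = of_real (r \<theta>)" if "\<bar>\<theta> - \<theta>0\<bar> < min e \<epsilon>" for \<theta>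
  proof -
    have *: "(complex_of_real \<theta>, complex_of_real (r \<theta>)) \<in> N" "complex_of_real (r \<theta>) \<in> ball (of_real (r \<theta>0)) \<delta>"
      using e(2)[of \<theta>] that by (auto simp: dist_real_def)
    have "E (of_real \<theta>, of_real (r \<theta>)) = E (of_real \<theta>0, of_real (r \<theta>0))"
      unfolding Ereal[OF *(1)] Ereal[OF base] level ..
    then show ?thesis using \<tau>(4)[of "of_real \<theta>" "of_real (r \<theta>)"] * that
      by (auto simp: dist_real_def abs_minus_commute)
  qed
  moreover have "\<tau> holomorphic_on ball (of_real \<theta>0) (min e \<epsilon>)"
    using \<tau>(3) by (rule holomorphic_on_subset) auto
  ultimately show ?thesis unfolding analytic_curve_def using e(1) \<tau>(1)
    by (metis min_less_iff_conj)
qed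

section \<open>Linear combinations and derivatives of real-analytic functions\<close>

lemma real_analytic_at_cong:
  assumes "real_analytic_at g p" "\<forall>\<^sub>F z in nhds p. g z = g' z"
  shows "real_analytic_at g' p"
proof -
  obtain c r where r: "r > 0" and sum: "\<And>z. z \<in> ball p r \<Longrightarrow>
      ((\<lambda>(i, j). (Re (z - p) ^ i * Im (z - p) ^ j) *\<^sub>R c i j) has_sum g z) UNIV"
    using assms(1) unfolding real_analytic_at_def by blast
  obtain d where d: "d > 0" "\<And>z. z \<in> ball p d \<Longrightarrow> g z = g' z"
    using assms(2) unfolding eventually_nhds_metric mem_ball by (metis dist_commute)
  show ?thesis unfolding real_analytic_at_def
  proof (intro exI[of _ c] exI[of _ "min r d"] conjI ballI)
    fix z assume "z \<in> ball p (min r d)"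
    then have "z \<in> ball p r" "z \<in> ball p d" by auto
    then show "((\<lambda>(i, j). (Re (z - p) ^ i * Im (z - p) ^ j) *\<^sub>R c i j) has_sum g' z) UNIV"
      unfolding d(2)[OF \<open>z \<in> ball p d\<close>, symmetric] by (intro sum)
  qed (use r d in auto)
qed

lemma real_analytic_at_lincomb:
  fixes g h :: "complex \<Rightarrow> real"
  assumes "real_analytic_at g p" "real_analytic_at h p"
  shows "real_analytic_at (\<lambda>z. a * g z + b * h z) p"
proof -
  obtain c r where r: "r > 0" and c: "\<And>z. z \<in> ball p r \<Longrightarrow>
      ((\<lambda>(i, j). (Re (z - p) ^ i * Im (z - p) ^ j) *\<^sub>R c i j) has_sum g z) UNIV"
    using assms(1) unfolding real_analytic_at_def by blast
  obtain c' r' where r': "r' > 0" and c': "\<And>z. z \<in> ball p r' \<Longrightarrow>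
      ((\<lambda>(i, j). (Re (z - p) ^ i * Im (z - p) ^ j) *\<^sub>R c' i j) has_sum h z) UNIV"
    using assms(2) unfolding real_analytic_at_def by blast
  show ?thesis unfolding real_analytic_at_def
  proof (intro exI[of _ "\<lambda>i j. a * c i j + b * c' i j"] exI[of _ "min r r'"] conjI ballI)
    fix z assume "z \<in> ball p (min r r')"
    then have "z \<in> ball p r" "z \<in> ball p r'" by auto
    from has_sum_add[OF has_sum_cmult_right[OF c[OF this(1)], of a] has_sum_cmult_right[OF c'[OF this(2)], of b]]
    show "((\<lambda>(i, j). (Re (z - p) ^ i * Im (z - p) ^ j) *\<^sub>R (a * c i j + b * c' i j)) has_sum a * g z + b * h z) UNIV"
      by (simp add: split_def algebra_simps)
  qed (use r r' in auto)
qed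

lemma real_analytic_at_differentiable:
  fixes g :: "complex \<Rightarrow> real"
  assumes "real_analytic_at g p"
  shows "g differentiable (at p)"
  using real_analytic_at_partials[OF assms] unfolding differentiable_def
  by (metis centre_in_ball)

lemma real_analytic_at_has_derivative:
  fixes g :: "complex \<Rightarrow> real"
  assumes "real_analytic_at g p"
  shows "(g has_derivative frechet_derivative g (at p)) (at p)"
  using real_analytic_at_differentiable[OF assms] by (simp add: frechet_derivative_works)

lemma real_analytic_at_frechet_derivative:
  fixes g :: "complex \<Rightarrow> real"
  assumes "real_analytic_at g p"
  shows "real_analytic_at (\<lambda>z. frechet_derivative g (at z) v) p"
proof -
  obtain gx gy r where g: "r > 0" "real_analytic_at gx p" "real_analytic_at gy p"
    and der: "\<And>z. z \<in> ball p r \<Longrightarrow> (g has_derivative (\<lambda>v. Re v * gx z + Im v * gy z)) (at z)"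
    by (rule real_analytic_at_partials[OF assms]) (rule that)
  have "frechet_derivative g (at z) v = Re v * gx z + Im v * gy z" if "z \<in> ball p r" for z
    using frechet_derivative_at[OF der[OF that]] by metis
  then have "\<forall>\<^sub>F z in nhds p. Re v * gx z + Im v * gy z = frechet_derivative g (at z) v"
    using eventually_nhds_in_open[of "ball p r" p] g(1) by (auto elim: eventually_mono)
  then show ?thesis
    by (rule real_analytic_at_cong[OF real_analytic_at_lincomb[OF g(2,3)]])
qed

lemma analytic_curve_compose_real:
  fixes g :: "complex \<Rightarrow> real"
  assumes "real_analytic_at g (z t)" "analytic_curve z t"
  shows "analytic_curve (\<lambda>x. of_real (g (z x))) t"
  using analytic_curve_compose[OF real_analytic_at_of_real[OF assms(1)] assms(2)] .

section \<open>Invariant functions of circle homeomorphisms\<close>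

lemma periodic_of_int:
  fixes h :: "real \<Rightarrow> 'a"
  assumes "\<And>x. h (x + 1) = h x"
  shows "h (x + of_int k) = h x"
proof -
  have nat: "h (x + of_nat n) = h x" for n x
  proof (induction n)
    case (Suc n)
    have "x + of_nat (Suc n) = x + of_nat n + 1" by simp
    then show ?case using assms Suc by metis
  qed simp
  show ?thesis
  proof (cases "k \<ge> 0")
    case True
    then show ?thesis using nat[of x "nat k"] by simp
  next
    case False
    then show ?thesis using nat[of "x + of_int k" "nat (- k)"] by simp
  qed
qed

text \<open>The displacement \<open>F x - x\<close> has period 1.\<close>

lemma lift_of_int:
  fixes F :: "real \<Rightarrow> real"
  assumes "\<And>x. F (x + 1) = F x + 1"
  shows "F (x + of_int k) = F x + of_int k"
  using periodic_of_int[of "\<lambda>x. F x - x" x k] assms by simp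

lemma lift_surj:
  fixes F :: "real \<Rightarrow> real"
  assumes "continuous_on UNIV F" "\<And>x k. F (x + of_int k) = F x + of_int k"
  shows "surj F"
proof (rule surjI)
  show "F (SOME x. F x = y) = y" for y
  proof (rule someI_ex)
    define k where "k = \<lfloor>y - F 0\<rfloor>"
    have "F (of_int k) = F 0 + of_int k" "F (of_int (k + 1)) = F 0 + of_int (k + 1)"
      using assms(2)[of 0] by (metis add_0)+
    moreover have "of_int k \<le> y - F 0" "y - F 0 < of_int k + 1" by (simp_all add: k_def)
    ultimately have "F (of_int k) \<le> y" "y \<le> F (of_int (k + 1))" by simp_all
    moreover have "continuous_on {of_int k..of_int (k + 1)} F"
      using assms(1) by (rule continuous_on_subset) simp
    ultimately show "\<exists>x. F x = y"
      using IVT'[of F "of_int k" y "of_int (k + 1)"] by auto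
  qed
qed

text \<open>The orbit of \<open>x\<close> decreases and is bounded below by \<open>s\<close>; its
  limit is a fixed point in [s, x], hence \<open>s\<close> itself, and \<open>h\<close> is constant
  along the orbit.\<close>

lemma invariant_eq_at_fixed_point:
  fixes G h :: "real \<Rightarrow> real"
  assumes G: "continuous_on UNIV G" "strict_mono G" and h: "continuous_on UNIV h" "\<And>x. h (G x) = h x"
    and s: "G s = s" "s < x" "\<And>y. s < y \<Longrightarrow> y \<le> x \<Longrightarrow> G y \<noteq> y" and "G x < x"
  shows "h x = h s"
proof -
  define X where "X n = (G ^^ n) x" for n
  have [simp]: "X (Suc n) = G (X n)" "X 0 = x" for n by (simp_all add: X_def)
  have "X (Suc n) \<le> X n" for n
    by (induction n) (use \<open>G x < x\<close> strict_mono_mono[OF G(2)] in \<open>auto simp: mono_def\<close>)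
  then have dec: "decseq X" by (rule decseq_SucI)
  have ge: "s \<le> X n" for n
    by (induction n) (use s strict_mono_mono[OF G(2)] in \<open>auto dest: monoD\<close>)
  obtain L where L: "X \<longlonglongrightarrow> L" "\<And>n. L \<le> X n"
    using decseq_convergent[OF dec, of s] ge by auto
  have "s \<le> L" using ge L(1) by (intro LIMSEQ_le_const) auto
  have cont: "isCont G L" "isCont h L"
    using G h by (auto simp: continuous_on_eq_continuous_at)
  have "(\<lambda>n. G (X n)) \<longlonglongrightarrow> G L" using isCont_tendsto_compose[OF cont(1) L(1)] .
  moreover have "(\<lambda>n. G (X n)) \<longlonglongrightarrow> L" using LIMSEQ_Suc[OF L(1)] by simp
  ultimately have "G L = L" by (rule LIMSEQ_unique)
  then have "L = s" using s(3)[of L] L(2)[of 0] \<open>s \<le> L\<close> by force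
  have "h (X n) = h x" for n by (induction n) (auto simp: h)
  then have "h L = h x" using isCont_tendsto_compose[OF cont(2) L(1)] by (simp add: LIMSEQ_const_iff)
  then show ?thesis using \<open>L = s\<close> by simp
qed

text \<open>Every point has an orbit converging to the nearest fixed point on its left, forward or
  backward according to the sign of \<open>G x - x\<close>. Hence \<open>h\<close> takes each of its
  values at a fixed point.\<close>

lemma invariant_const_of_countable_fixed_points:
  fixes G h :: "real \<Rightarrow> real"
  assumes G: "continuous_on UNIV G" "strict_mono G" "\<And>x k. G (x + of_int k) = G x + of_int k"
    and h: "continuous_on UNIV h" "\<And>x. h (G x) = h x"
    and fix0: "G a = a" and count: "countable {x. G x = x}"
  shows "h x = h y"
proof -
  have surj: "surj G" using G by (intro lift_surj)
  define Gi where "Gi = inv G"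
  have G_Gi: "G (Gi x) = x" for x using surj by (simp add: Gi_def surj_f_inv_f)
  have Gi_G: "Gi (G x) = x" for x
    using strict_mono_imp_inj_on[OF G(2)] by (simp add: Gi_def)
  have mono: "strict_mono Gi"
    unfolding strict_mono_def using G(2) by (metis G_Gi not_less_iff_gr_or_eq strict_monoD)
  have "range Gi = UNIV" using Gi_G by (metis surjI)
  then have cont: "continuous_on UNIV Gi"
    by (intro continuous_onI_mono) (use strict_mono_mono[OF mono] in \<open>auto dest: monoD\<close>)
  have "\<exists>s. G s = s \<and> h x = h s" for x
  proof -
    define S where "S = {s. G s = s \<and> s \<le> x}"
    \<comment> \<open>Integer translates of \<open>a\<close> are fixed as well, so there are fixed
      points to the left of any \<open>x\<close>.\<close>
    have "a + of_int \<lfloor>x - a\<rfloor> \<in> S"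
      using fix0 G(3)[of a "\<lfloor>x - a\<rfloor>"] of_int_floor_le[of "x - a"]
      unfolding S_def mem_Collect_eq by linarith
    then have "S \<noteq> {}" by auto
    have bdd: "bdd_above S" by (auto simp: S_def)
    have "closed {s. G s = s}" using G(1) by (intro closed_Collect_eq continuous_on_id)
    then have "closed S" using closed_Int[of "{s. G s = s}" "{..x}"] by (simp add: S_def Int_def)
    define s where "s = Sup S"
    have "s \<in> S" unfolding s_def by (rule closed_contains_Sup) fact+
    then have s: "G s = s" "s \<le> x" by (auto simp: S_def)
    have no: "G y \<noteq> y" if "s < y" "y \<le> x" for y
      using that cSup_upper[OF _ bdd, of y] by (auto simp: s_def S_def)
    have "h x = h s"
    proof (cases "s = x")
      case False
      with s have "s < x" by simp
      \<comment> \<open>A point moved to the right by \<open>G\<close> is moved to the left by the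
        inverse, under which \<open>h\<close> is invariant too.\<close>
      consider "G x < x" | "Gi x < x"
        using no[of x] \<open>s < x\<close> strict_monoD[OF mono, of x "G x"] Gi_G[of x] by force
      then show ?thesis
      proof cases
        case 1
        show ?thesis by (rule invariant_eq_at_fixed_point[OF G(1,2) h s(1) \<open>s < x\<close> no 1])
      next
        case 2
        have "h (Gi x) = h x" for x using h(2)[of "Gi x"] by (simp add: G_Gi)
        moreover have "Gi s = s" using Gi_G[of s] s by simp
        moreover have "Gi y \<noteq> y" if "s < y" "y \<le> x" for y using no[OF that] G_Gi[of y] by metis
        ultimately show ?thesis
          using invariant_eq_at_fixed_point[OF cont mono h(1) _ _ \<open>s < x\<close> _ 2] by blast
      qed
    qed simp
    then show ?thesis using s by blast
  qed
  then have "range h \<subseteq> h ` {x. G x = x}" by blast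
  then have "countable (range h)" using count by (meson countable_image countable_subset)
  moreover have "connected (range h)" using h(1) by (intro connected_continuous_image) auto
  ultimately show ?thesis
    using connected_uncountable[of "range h" "h x" "h y"] by blast
qed

text \<open>
  A gap \<open>(a, b)\<close> of the closed set where \<open>h\<close> attains its maximum is mapped by the iterates of \<open>F\<close> to
  gaps that are pairwise disjoint modulo 1, since a common endpoint would be periodic.
\<close>

lemma invariant_const_of_no_periodic_point:
  fixes F h :: "real \<Rightarrow> real"
  assumes F: "continuous_on UNIV F" "strict_mono F" "\<And>x. F (x + 1) = F x + 1"
    and h: "continuous_on UNIV h" "\<And>x. h (x + 1) = h x" "\<And>x. h (F x) = h x"
    and per: "\<And>q p x. q > 0 \<Longrightarrow> (F ^^ q) x \<noteq> x + of_int p"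
  shows "h x = h y"
proof -
  have hk: "h (x + of_int k) = h x" for x k using h(2) by (rule periodic_of_int)
  have Fk: "F (x + of_int k) = F x + of_int k" for x k using F(3) by (rule lift_of_int)
  have surj: "surj F" using F(1) Fk by (rule lift_surj)
  have hFn: "h ((F ^^ n) x) = h x" for n x by (induction n) (auto simp: h)
  have Fn_mono: "strict_mono (F ^^ n)" for n
    by (induction n) (use F(2) in \<open>auto simp: strict_mono_def\<close>)
  have Fn_surj: "surj (F ^^ n)" for n using surj by (rule surj_fn)
  have "\<exists>x\<in>{0..1}. \<forall>y\<in>{0..1}. h y \<le> h x"
    by (rule continuous_attains_sup) (use h(1) in \<open>auto intro: continuous_on_subset\<close>)
  then obtain x0 where x0: "\<And>y. 0 \<le> y \<Longrightarrow> y \<le> 1 \<Longrightarrow> h y \<le> h x0"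
    by (metis atLeastAtMost_iff)
  define M where "M = h x0"
  have le: "h x \<le> M" for x
    using x0[of "frac x"] hk[of x "- \<lfloor>x\<rfloor>"] frac_lt_1[of x] by (simp add: frac_def M_def)
  have "h y = M" for y
  proof (rule ccontr)
    assume "h y \<noteq> M"
    with le[of y] have y: "h y < M" by simp
    define K where "K = {x. h x = M}"
    have "closed K" unfolding K_def using h(1) by (intro closed_Collect_eq) auto
    define S T where "S = K \<inter> {..y}" and "T = K \<inter> {y..}"
    have "x0 + of_int \<lfloor>y - x0\<rfloor> \<in> S" "x0 + of_int \<lceil>y - x0\<rceil> \<in> T"
      using of_int_floor_le[of "y - x0"] le_of_int_ceiling[of "y - x0"]
      by (simp_all add: S_def T_def K_def M_def hk del: le_of_int_ceiling of_int_floor_le)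
    then have ne: "S \<noteq> {}" "T \<noteq> {}" by auto
    have bdd: "bdd_above S" "bdd_below T" by (auto simp: S_def T_def)
    have cl: "closed S" "closed T" using \<open>closed K\<close> by (auto simp: S_def T_def)
    \<comment> \<open>The endpoints of the gap around \<open>y\<close>: the nearest points on either
      side where the maximum \<open>M\<close> is attained.\<close>
    define a b where "a = Sup S" and "b = Inf T"
    have "a \<in> S" unfolding a_def by (rule closed_contains_Sup) fact+
    have "b \<in> T" unfolding b_def by (rule closed_contains_Inf) fact+
    have ay: "a < y" and ha: "h a = M"
      using \<open>a \<in> S\<close> y by (auto simp: S_def K_def order_le_less)
    have yb: "y < b" using \<open>b \<in> T\<close> y by (auto simp: T_def K_def order_le_less)
    have gap: "h x \<noteq> M" if "a < x" "x < b" for x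
      using that cSup_upper[OF _ bdd(1), of x] cInf_lower[OF _ bdd(2), of x]
      by (cases "x \<le> y") (auto simp: a_def b_def S_def T_def K_def)
    define A B where "A n = (F ^^ n) a" and "B n = (F ^^ n) b" for n
    have hA: "h (A n) = M" for n by (simp add: A_def hFn ha)
    have gap_n: "h x \<noteq> M" if "A n < x" "x < B n" for x n
    proof -
      obtain x' where x': "x = (F ^^ n) x'" using Fn_surj[of n] by (metis surjD)
      then have "a < x'" "x' < b" using that Fn_mono[of n] by (auto simp: A_def B_def strict_mono_less)
      then show ?thesis using gap x' hFn by simp
    qed
    \<comment> \<open>The tolerance \<open>M - h y\<close> is the contradiction aimed at: two points
      carrying the values \<open>M\<close> and \<open>h y\<close> cannot be too close. The interval
      exceeds [0, 1] because the second point may lie up to 1 to the right of a point of [0,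
      1).\<close>
    have "uniformly_continuous_on {-1..2} h"
      by (rule compact_uniformly_continuous) (use h(1) in \<open>auto intro: continuous_on_subset\<close>)
    then obtain \<delta>' where \<delta>': "\<delta>' > 0"
      "\<And>u v. u \<in> {-1..2} \<Longrightarrow> v \<in> {-1..2} \<Longrightarrow> dist u v < \<delta>' \<Longrightarrow> dist (h u) (h v) < M - h y"
      unfolding uniformly_continuous_on_def using y by (metis diff_gt_0_iff_gt)
    define \<delta> where "\<delta> = min \<delta>' 1"
    have \<delta>: "0 < \<delta>" "\<delta> \<le> 1" "\<delta> \<le> \<delta>'" using \<delta>' by (auto simp: \<delta>_def)
    \<comment> \<open>All gaps are supposed to have length at least \<delta>, and two left ends,
      reduced by integers, differ by \<open>d\<close> with 0 \<le> d < \<delta>. If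
      \<open>d = 0\<close>, a left end is periodic modulo 1; otherwise a maximum point lies inside a
      gap.\<close>
    have ord: "False" if "\<And>n. \<delta> \<le> B n - A n" "n \<noteq> m" "0 \<le> d" "d < \<delta>" "A m - of_int l = A n - of_int k + d"
      for n m k l d
    proof -
      have "A m = A n + of_int (l - k) + d" using that by simp
      show False
      proof (cases "d = 0")
        case True
        have "A m = A n + of_int (l - k)" "A n = A m + of_int (k - l)" using that True by simp_all
        moreover have "A m = (F ^^ (m - n)) (A n)" if "n < m"
          using funpow_add[of "m - n" n F] that by (simp add: A_def)
        moreover have "A n = (F ^^ (n - m)) (A m)" if "m < n"
          using funpow_add[of "n - m" m F] that by (simp add: A_def)
        ultimately show False using per[of "m - n" "A n"] per[of "n - m" "A m"] \<open>n \<noteq> m\<close>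
          by (metis linorder_less_linear zero_less_diff)
      next
        case False
        have "h (A n + d) = h (A m + of_int (k - l))" using that by (simp add: algebra_simps)
        then have "h (A n + d) = M" unfolding hk hA .
        then show False using gap_n[of n "A n + d"] False that(1)[of n] that by auto
      qed
    qed
    \<comment> \<open>Were no gap shorter than \<delta>, compactness of [0, 1] would provide two
      different indices whose reduced left ends are closer than \<delta>.\<close>
    obtain n where n: "B n - A n < \<delta>"
    proof (rule ccontr)
      assume "\<not> thesis"
      then have big: "\<delta> \<le> B n - A n" for n using that[of n] by linarith
      have "\<And>n. frac (A n) \<in> {0..1}" by (simp add: order_less_imp_le[OF frac_lt_1])
      then obtain L r where r: "strict_mono r" "((\<lambda>n. frac (A n)) \<circ> r) \<longlonglongrightarrow> L"
        using compact_Icc[of 0 "1::real"] unfolding compact_def by (metis (no_types, lifting))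
      then obtain N where "\<And>m n. m \<ge> N \<Longrightarrow> n \<ge> N \<Longrightarrow> dist (frac (A (r m))) (frac (A (r n))) < \<delta>"
        using LIMSEQ_imp_Cauchy[OF r(2)] \<delta>(1) unfolding Cauchy_def o_def by metis
      from this[of N "Suc N"] have *: "\<bar>frac (A (r N)) - frac (A (r (Suc N)))\<bar> < \<delta>"
        by (simp add: dist_real_def)
      have "r N \<noteq> r (Suc N)" using r(1) by (simp add: strict_mono_eq)
      define n1 n2 where "n1 = r N" and "n2 = r (Suc N)"
      have *: "n1 \<noteq> n2" "\<bar>frac (A n1) - frac (A n2)\<bar> < \<delta>"
        using * \<open>r N \<noteq> r (Suc N)\<close> by (simp_all add: n1_def n2_def)
      show False
      proof (cases "frac (A n1) \<le> frac (A n2)")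
        case True
        show False
          by (rule ord[OF big *(1), of "frac (A n2) - frac (A n1)" "\<lfloor>A n2\<rfloor>" "\<lfloor>A n1\<rfloor>"])
             (use True *(2) in \<open>auto simp: frac_def\<close>)
      next
        case False
        show False
          by (rule ord[OF big *(1)[symmetric], of "frac (A n1) - frac (A n2)" "\<lfloor>A n1\<rfloor>" "\<lfloor>A n2\<rfloor>"])
             (use False *(2) in \<open>auto simp: frac_def\<close>)
      qed
    qed
    \<comment> \<open>The left end and the image of \<open>y\<close> are reduced by the same
      integer, so their distance stays below \<delta> while \<open>h\<close> keeps the values
      \<open>M\<close> and \<open>h y\<close>.\<close>
    define u v where "u = frac (A n)" and "v = (F ^^ n) y + of_int (- \<lfloor>A n\<rfloor>)"
    have "A n < (F ^^ n) y" "(F ^^ n) y < B n"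
      using ay yb Fn_mono[of n] by (auto simp: A_def B_def strict_mono_less)
    then have "u < v" "v < u + \<delta>" using n by (auto simp: u_def v_def frac_def)
    moreover have "0 \<le> u" "u < 1" by (auto simp: u_def frac_lt_1)
    ultimately have "dist (h u) (h v) < M - h y"
      using \<delta> by (intro \<delta>'(2)) (auto simp: dist_real_def)
    moreover have "h v = h y" unfolding v_def hk hFn ..
    moreover have "h u = M" using hk[of "A n" "- \<lfloor>A n\<rfloor>"] hA by (simp add: u_def frac_def)
    ultimately show False by (simp add: dist_real_def)
  qed
  then show ?thesis by metis
qed

text \<open>Subtracting the integer \<open>p\<close> by which a periodic point is displaced turns
  \<open>F ^^ q\<close> into a lift \<open>G\<close> with a true fixed point; integer shifts do not
  affect \<open>h\<close>.\<close>

lemma invariant_const_of_countable_periodic_points: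
  fixes F h :: "real \<Rightarrow> real"
  assumes F: "continuous_on UNIV F" "strict_mono F" "\<And>x. F (x + 1) = F x + 1"
    and h: "continuous_on UNIV h" "\<And>x. h (x + 1) = h x" "\<And>x. h (F x) = h x"
    and count: "\<And>q p. q > 0 \<Longrightarrow> countable {x. (F ^^ q) x = x + of_int p}"
  shows "h x = h y"
proof (cases "\<exists>q p x. q > 0 \<and> (F ^^ q) x = x + of_int p")
  case False
  then show ?thesis by (intro invariant_const_of_no_periodic_point[OF F h]) blast
next
  case True
  then obtain q p a where q: "q > 0" "(F ^^ q) a = a + of_int p" by blast
  define G where "G x = (F ^^ q) x + of_int (- p)" for x
  have hk: "h (x + of_int k) = h x" for x k using h(2) by (rule periodic_of_int)
  have "(F ^^ n) (x + 1) = (F ^^ n) x + 1" for n x by (induction n) (auto simp: F)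
  then have Fk: "(F ^^ n) (x + of_int k) = (F ^^ n) x + of_int k" for n x k by (rule lift_of_int)
  have hFn: "h ((F ^^ n) x) = h x" for n x by (induction n) (auto simp: h)
  have "strict_mono (F ^^ n)" for n
    by (induction n) (use F(2) in \<open>auto simp: strict_mono_def\<close>)
  then have "strict_mono G" by (auto simp: G_def strict_mono_def)
  moreover have "continuous_on UNIV (F ^^ n)" for n
  proof (induction n)
    case (Suc n)
    then show ?case using continuous_on_compose2[OF F(1) Suc] by (simp add: o_def)
  qed (simp add: id_def)
  then have "continuous_on UNIV G" unfolding G_def by (intro continuous_intros) auto
  moreover have "h (G x) = h x" for x unfolding G_def hk hFn ..
  moreover have "countable {x. G x = x}"
    using count[OF q(1), of p] by (simp add: G_def algebra_simps)
  moreover have "G a = a" using q by (simp add: G_def)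
  moreover have "G (x + of_int k) = G x + of_int k" for x k by (simp add: G_def Fk)
  ultimately show ?thesis
    using invariant_const_of_countable_fixed_points[of G h a x y] h(1) by blast
qed

section \<open>Dynamics on the level curves\<close>

text \<open>Where \<open>D\<close> is nonzero it is nonzero on a whole interval, which does not fit
  into the countable set \<open>B\<close>.\<close>

lemma countable_zero_exceptions:
  fixes D :: "real \<Rightarrow> real"
  assumes "continuous_on {a<..<b} D" "countable B" "\<And>x. x \<in> {a<..<b} \<Longrightarrow> x \<notin> B \<Longrightarrow> D x = 0"
    and "x \<in> {a<..<b}"
  shows "D x = 0"
proof (rule ccontr)
  assume "D x \<noteq> 0"
  define S where "S = {a<..<b} \<inter> D -` (- {0})"
  have "open S" unfolding S_def using assms(1) by (intro continuous_open_preimage) auto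
  moreover have "x \<in> S" using assms(4) \<open>D x \<noteq> 0\<close> by (auto simp: S_def)
  ultimately obtain e where "e > 0" "ball x e \<subseteq> S" using openE by blast
  then have "{x<..<x + e} \<subseteq> S" by (auto simp: ball_def dist_real_def subset_iff)
  also have "S \<subseteq> B" using assms(3) by (auto simp: S_def)
  finally have "countable {x<..<x + e}" using assms(2) countable_subset by blast
  then show False using \<open>e > 0\<close> uncountable_open_interval[of x "x + e"] by simp
qed

section \<open>Functions increasing along rays\<close>

text \<open>The ball is part of the definition because nothing is known about \<open>I\<close>
  outside it, where low values may recur.\<close>

definition sublevel_disc :: "(complex \<Rightarrow> real) \<Rightarrow> real \<Rightarrow> real \<Rightarrow> complex set" where
  "sublevel_disc I \<rho> C = {z \<in> ball 0 \<rho>. I z < C}"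

lemma polar: "z \<noteq> 0 \<Longrightarrow> z = of_real (norm z) * sgn z" for z :: complex
  by (simp add: sgn_div_norm scaleR_conv_of_real)

text \<open>Positivity of the derivative at \<open>z\<close> in the direction \<open>z\<close> is
  what a non-degenerate minimum provides near 0. It replaces a change to normal coordinates: levels
  can be treated in ordinary polar coordinates.\<close>

locale radial_analytic =
  fixes I :: "complex \<Rightarrow> real" and \<rho> :: real
  assumes \<rho>_pos: "0 < \<rho>"
    and an_I: "\<And>z. z \<in> ball 0 \<rho> \<Longrightarrow> real_analytic_at I z"
    and radial: "\<And>z. z \<in> ball 0 \<rho> \<Longrightarrow> z \<noteq> 0 \<Longrightarrow> frechet_derivative I (at z) z > 0"
begin

abbreviation DI :: "complex \<Rightarrow> complex \<Rightarrow> real" where "DI z \<equiv> frechet_derivative I (at z)"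

lemma I_has_derivative: "z \<in> ball 0 \<rho> \<Longrightarrow> (I has_derivative DI z) (at z)"
  using real_analytic_at_differentiable[OF an_I] by (simp add: frechet_derivative_works)

lemma I_isCont: "z \<in> ball 0 \<rho> \<Longrightarrow> isCont I z"
  using has_derivative_continuous[OF I_has_derivative] .

lemma continuous_on_I: "continuous_on (ball 0 \<rho>) I"
  using I_isCont by (intro continuous_at_imp_continuous_on) auto

lemma I_ray_derivative:
  assumes "norm (of_real t * w) < \<rho>"
  shows "((\<lambda>t. I (of_real t * w)) has_real_derivative DI (of_real t * w) w) (at t)"
proof -
  have I: "(I has_derivative DI (of_real t * w)) (at (of_real t * w))"
    using assms by (intro I_has_derivative) auto
  have "((\<lambda>t. of_real t * w) has_derivative (\<lambda>h. of_real h * w)) (at t)"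
    by (auto intro!: derivative_eq_intros)
  then have "((\<lambda>t. I (of_real t * w)) has_derivative (\<lambda>h. DI (of_real t * w) (of_real h * w))) (at t)"
    by (rule has_derivative_compose[where g = I]) (rule I)
  moreover have "DI (of_real t * w) (of_real h * w) = DI (of_real t * w) w * h" for h
    using linear_scale[OF has_derivative_linear[OF I], of h w] by (simp add: scaleR_conv_of_real)
  ultimately show ?thesis by (simp add: has_field_derivative_def)
qed

lemma DI_ray_pos:
  assumes "norm w = 1" "0 < t" "t < \<rho>"
  shows "0 < DI (of_real t * w) w"
proof -
  have I: "(I has_derivative DI (of_real t * w)) (at (of_real t * w))"
    using assms by (intro I_has_derivative) (auto simp: norm_mult)
  have "0 < DI (of_real t * w) (of_real t * w)"
    using assms by (intro radial) (auto simp: norm_mult)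
  also have "\<dots> = t * DI (of_real t * w) w"
    using linear_scale[OF has_derivative_linear[OF I], of t w] by (simp add: scaleR_conv_of_real)
  finally show ?thesis using assms by (simp add: zero_less_mult_iff)
qed

lemma I_ray_continuous:
  assumes "norm w = 1"
  shows "continuous_on {0..<\<rho>} (\<lambda>t. I (of_real t * w))"
  by (rule continuous_on_compose2[OF continuous_on_I]) (use assms in \<open>auto intro!: continuous_intros simp: norm_mult\<close>)

lemma I_ray_mono:
  assumes "norm w = 1" "0 \<le> s" "s < t" "t < \<rho>"
  shows "I (of_real s * w) < I (of_real t * w)"
proof (rule DERIV_pos_imp_increasing_open[OF assms(3)])
  show "\<exists>y. ((\<lambda>t. I (of_real t * w)) has_real_derivative y) (at x) \<and> 0 < y" if "s < x" "x < t" for x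
    using I_ray_derivative[of x w] DI_ray_pos[of w x] that assms by (auto simp: norm_mult)
  show "continuous_on {s..t} (\<lambda>t. I (of_real t * w))"
    using I_ray_continuous[OF assms(1)] by (rule continuous_on_subset) (use assms in auto)
qed

lemma I_min:
  assumes "z \<in> ball 0 \<rho>" "z \<noteq> 0"
  shows "I 0 < I z"
  using I_ray_mono[of "sgn z" 0 "norm z"] assms polar[of z] by (simp add: norm_sgn)

text \<open>\<open>m\<close> is the minimum of \<open>I\<close> on the circle of radius
  \<open>e\<close>; beyond the circle \<open>I\<close> has grown further along each ray. The bound
  on the circle is kept because it shows that every ray reaches the level \<open>m\<close>.\<close>

lemma sublevel_disc_small:
  assumes "0 < e" "e < \<rho>"
  obtains m where "I 0 < m" "\<And>z. norm z = e \<Longrightarrow> m \<le> I z" "sublevel_disc I \<rho> m \<subseteq> ball 0 e"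
proof -
  have sphere: "sphere 0 e \<subseteq> ball 0 \<rho>" using assms by auto
  have "\<exists>z\<in>sphere 0 e. \<forall>w\<in>sphere 0 e. I z \<le> I w"
    by (rule continuous_attains_inf) (use assms continuous_on_subset[OF continuous_on_I sphere] in auto)
  then obtain z0 where z0: "norm z0 = e" "\<And>w. norm w = e \<Longrightarrow> I z0 \<le> I w" by auto
  have "norm z < e" if "z \<in> sublevel_disc I \<rho> (I z0)" for z
  proof (rule ccontr)
    assume "\<not> norm z < e"
    then have z: "e \<le> norm z" "z \<noteq> 0" using assms by auto
    have n: "norm z < \<rho>" "I z < I z0" using that by (auto simp: sublevel_disc_def)
    have "I (of_real e * sgn z) \<le> I (of_real (norm z) * sgn z)"
      using I_ray_mono[of "sgn z" e "norm z"] z n assms by (cases "e = norm z") (auto simp: norm_sgn)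
    also have "\<dots> = I z" using polar[OF z(2)] by simp
    finally show False using z0(2)[of "of_real e * sgn z"] n z assms by (simp add: norm_mult norm_sgn)
  qed
  then show ?thesis using I_min[of z0] z0 assms that[of "I z0"] by fastforce
qed

end

text \<open>\<open>reach\<close> makes every level between \<open>I 0\<close> and \<open>C\<close>
  meet every ray, \<open>f_disc\<close> makes the sublevel disc invariant,
  \<open>near_rotation\<close> gives the change of angle a single-valued choice, and
  \<open>inj\<close> makes the resulting lift monotone.\<close>

locale elliptic_integral = radial_analytic I \<rho> for I \<rho> +
  fixes f :: "complex \<Rightarrow> complex" and C \<omega> :: real
  assumes I0_less: "I 0 < C"
    and an_f: "\<And>z. z \<in> ball 0 \<rho> \<Longrightarrow> real_analytic_at f z"
    and reach: "\<And>w. norm w = 1 \<Longrightarrow> \<exists>t. 0 < t \<and> t < \<rho> \<and> C \<le> I (of_real t * w)"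
    and f_disc: "\<And>z. z \<in> sublevel_disc I \<rho> C \<Longrightarrow> norm (f z) < \<rho> \<and> I (f z) = I z"
    and near_rotation: "\<And>z. z \<in> sublevel_disc I \<rho> C \<Longrightarrow> z \<noteq> 0 \<Longrightarrow>
      norm (f z - cis (2 * pi * \<omega>) * z) < norm z"
    and inj: "inj_on f (sublevel_disc I \<rho> C)"
    and f0: "f 0 = 0" and der0: "(f has_derivative (\<lambda>z. cis (2 * pi * \<omega>) * z)) (at 0)"
    and irrational: "\<omega> \<notin> \<rat>"
begin

abbreviation A :: "complex set" where "A \<equiv> sublevel_disc I \<rho> C"

lemma A_iff: "z \<in> A \<longleftrightarrow> norm z < \<rho> \<and> I z < C"
  by (auto simp: sublevel_disc_def)

lemma f_isCont: "z \<in> ball 0 \<rho> \<Longrightarrow> isCont f z"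
  by (rule real_analytic_at_isCont_complex[OF an_f])

lemma open_A: "open A"
  using continuous_open_preimage[OF continuous_on_I open_ball open_lessThan[of C]]
  by (simp add: sublevel_disc_def vimage_def Int_def)

lemma zero_in_A: "0 \<in> A"
  using \<rho>_pos I0_less by (simp add: A_iff)

lemma A_subset: "A \<subseteq> ball 0 \<rho>"
  by (auto simp: sublevel_disc_def)

lemma f_in_A: "z \<in> A \<Longrightarrow> f z \<in> A"
  using f_disc by (simp add: A_iff)

lemma I_f: "z \<in> A \<Longrightarrow> I (f z) = I z"
  using f_disc by simp

lemma funpow_f_in_A: "z \<in> A \<Longrightarrow> (f ^^ n) z \<in> A"
  by (induction n) (auto intro: f_in_A)

text \<open>Moving towards 0 along a ray can only lower \<open>I\<close>.\<close>

lemma A_star: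
  assumes "z \<in> A" "0 \<le> s" "s \<le> 1"
  shows "of_real s * z \<in> A"
proof (cases "z = 0 \<or> s = 1")
  case False
  then have z: "z \<noteq> 0" "s < 1" using assms by auto
  have z\<rho>: "norm z < \<rho>" using assms by (simp add: A_iff)
  have "s * norm z < norm z" using z by simp
  then have "I (of_real (s * norm z) * sgn z) < I (of_real (norm z) * sgn z)"
    using z z\<rho> assms by (intro I_ray_mono) (auto simp: norm_sgn)
  moreover have "of_real (s * norm z) * sgn z = of_real s * z"
    using polar[OF z(1)] by (metis mult.assoc of_real_mult)
  ultimately have "I (of_real s * z) < I z" using polar[OF z(1)] by metis
  moreover have "norm (of_real s * z) < \<rho>"
    using \<open>s * norm z < norm z\<close> z\<rho> assms by (simp add: norm_mult)
  ultimately show ?thesis using assms by (simp add: A_iff)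
qed (use assms zero_in_A in auto)

text \<open>By the star shape, the parameters, negative ones included, for which a line through 0
  runs in \<open>A\<close> form an open interval around 0. These intervals are the domains for the
  identity theorem along lines.\<close>

lemma line_open_connected:
  defines "S \<equiv> \<lambda>z. {t. of_real t * z \<in> A}"
  shows "open (S z)" "connected (S z)" "0 \<in> S z"
proof -
  have "open ((\<lambda>t. of_real t * z) -` A)" by (intro open_vimage open_A continuous_intros)
  then show "open (S z)" by (simp add: S_def vimage_def)
  show 0: "0 \<in> S z" by (simp add: S_def zero_in_A)
  have "closed_segment 0 t \<subseteq> S z" if "t \<in> S z" for t
  proof
    fix s assume "s \<in> closed_segment 0 t"
    then obtain u where u: "s = u * t" "0 \<le> u" "u \<le> 1" by (auto simp: in_segment)
    have "of_real u * (of_real t * z) \<in> A" by (rule A_star) (use that u in \<open>simp_all add: S_def\<close>)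
    then show "s \<in> S z" by (simp add: S_def u mult.assoc)
  qed
  then have "starlike (S z)" using 0 by (auto simp: starlike_def)
  then show "connected (S z)" by (rule starlike_imp_connected)
qed

section \<open>Levels in polar coordinates\<close>

lemma radius_ex1:
  assumes w: "norm w = 1" and c: "I 0 < c" "c < C"
  shows "\<exists>!t. 0 < t \<and> t < \<rho> \<and> I (of_real t * w) = c"
proof (rule ex_ex1I)
  obtain T where T: "0 < T" "T < \<rho>" "C \<le> I (of_real T * w)" using reach[OF w] by blast
  have "continuous_on {0..T} (\<lambda>t. I (of_real t * w))"
    using I_ray_continuous[OF w] by (rule continuous_on_subset) (use T in auto)
  then obtain t where t: "0 \<le> t" "t \<le> T" "I (of_real t * w) = c"
    using IVT'[of "\<lambda>t. I (of_real t * w)" 0 c T] c T by auto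
  then have "t \<noteq> 0" using c by auto
  then show "\<exists>t. 0 < t \<and> t < \<rho> \<and> I (of_real t * w) = c" using t T by (intro exI[of _ t]) auto
next
  show "t = t'" if "0 < t \<and> t < \<rho> \<and> I (of_real t * w) = c" "0 < t' \<and> t' < \<rho> \<and> I (of_real t' * w) = c" for t t'
    using I_ray_mono[OF w, of t t'] I_ray_mono[OF w, of t' t] that by (cases t t' rule: linorder_cases) auto
qed

text \<open>Meaningful for \<open>I 0 < c < C\<close> only, where the level \<open>c\<close> meets every ray exactly once.\<close>

definition radius :: "real \<Rightarrow> real \<Rightarrow> real" where
  "radius c \<theta> = (THE t. 0 < t \<and> t < \<rho> \<and> I (of_real t * cis (2 * pi * \<theta>)) = c)"

definition curve :: "real \<Rightarrow> real \<Rightarrow> complex" where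
  "curve c \<theta> = of_real (radius c \<theta>) * cis (2 * pi * \<theta>)"

lemma radius:
  assumes "c \<in> {I 0<..<C}"
  shows "0 < radius c \<theta>" "radius c \<theta> < \<rho>" "I (curve c \<theta>) = c"
  using theI'[OF radius_ex1[of "cis (2 * pi * \<theta>)" c]] assms
  by (auto simp: radius_def curve_def)

lemma radius_eqI:
  assumes "c \<in> {I 0<..<C}" "0 < t" "t < \<rho>" "I (of_real t * cis (2 * pi * \<theta>)) = c"
  shows "radius c \<theta> = t"
  using the1_equality[OF radius_ex1[of "cis (2 * pi * \<theta>)" c], of t] assms
  by (auto simp: radius_def)

lemma less_radius_iff:
  assumes "c \<in> {I 0<..<C}" "0 \<le> t" "t < \<rho>"
  shows "t < radius c \<theta> \<longleftrightarrow> I (of_real t * cis (2 * pi * \<theta>)) < c"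
    and "radius c \<theta> < t \<longleftrightarrow> c < I (of_real t * cis (2 * pi * \<theta>))"
  using I_ray_mono[of "cis (2 * pi * \<theta>)" t "radius c \<theta>"] I_ray_mono[of "cis (2 * pi * \<theta>)" "radius c \<theta>" t]
    radius[OF assms(1), of \<theta>] assms
  by (cases t "radius c \<theta>" rule: linorder_cases; auto simp: curve_def)+

text \<open>Comparing a fixed \<open>t\<close> with the radius amounts to comparing \<open>I\<close>
  at a point of the ray with \<open>c\<close>, an open condition in level and angle jointly.
  Continuity in the angle serves the circle maps, continuity in the level the passage to exceptional
  levels.\<close>

lemma continuous_on_radius: "continuous_on ({I 0<..<C} \<times> UNIV) (\<lambda>p. radius (fst p) (snd p))"
  unfolding continuous_on_def
proof
  let ?S = "{I 0<..<C} \<times> (UNIV :: real set)"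
  fix p0 assume p0: "p0 \<in> ?S"
  define c0 \<theta>0 where "c0 = fst p0" and "\<theta>0 = snd p0"
  have c0: "c0 \<in> {I 0<..<C}" using p0 by (auto simp: c0_def)
  have inS: "\<forall>\<^sub>F p in at p0 within ?S. p \<in> ?S" by (simp add: eventually_at_filter)
  have lim: "((\<lambda>p. I (of_real t * cis (2 * pi * snd p)) - fst p) \<longlongrightarrow> I (of_real t * cis (2 * pi * \<theta>0)) - c0) (at p0 within ?S)"
    if "0 \<le> t" "t < \<rho>" for t
  proof (intro tendsto_diff)
    have "((\<lambda>p. of_real t * cis (2 * pi * snd p)) \<longlongrightarrow> of_real t * cis (2 * pi * \<theta>0)) (at p0 within ?S)"
      unfolding \<theta>0_def by (intro tendsto_intros)
    then show "((\<lambda>p. I (of_real t * cis (2 * pi * snd p))) \<longlongrightarrow> I (of_real t * cis (2 * pi * \<theta>0))) (at p0 within ?S)"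
      by (rule isCont_tendsto_compose[rotated]) (use that in \<open>auto intro!: I_isCont simp: norm_mult\<close>)
    show "(fst \<longlongrightarrow> c0) (at p0 within ?S)" unfolding c0_def by (intro tendsto_intros)
  qed
  show "((\<lambda>p. radius (fst p) (snd p)) \<longlongrightarrow> radius (fst p0) (snd p0)) (at p0 within ?S)"
    unfolding c0_def[symmetric] \<theta>0_def[symmetric]
  proof (rule order_tendstoI)
    fix a assume "a < radius c0 \<theta>0"
    then obtain t where t: "max a 0 < t" "t < radius c0 \<theta>0"
      using dense[of "max a 0" "radius c0 \<theta>0"] radius(1)[OF c0] by auto
    then have t': "0 \<le> t" "t < \<rho>" using radius(2)[OF c0, of \<theta>0] by auto
    then have "I (of_real t * cis (2 * pi * \<theta>0)) - c0 < 0" using less_radius_iff(1)[OF c0 t'] t by simp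
    from order_tendstoD(2)[OF lim[OF t'] this] inS
    show "\<forall>\<^sub>F p in at p0 within ?S. a < radius (fst p) (snd p)"
    proof eventually_elim
      case (elim p)
      then have "t < radius (fst p) (snd p)" using less_radius_iff(1)[OF _ t', of "fst p" "snd p"] by auto
      then show ?case using t by simp
    qed
  next
    fix a assume "radius c0 \<theta>0 < a"
    then obtain t where t: "radius c0 \<theta>0 < t" "t < min a \<rho>"
      using dense[of "radius c0 \<theta>0" "min a \<rho>"] radius(2)[OF c0] by auto
    then have t': "0 \<le> t" "t < \<rho>" using radius(1)[OF c0, of \<theta>0] by auto
    then have "0 < I (of_real t * cis (2 * pi * \<theta>0)) - c0" using less_radius_iff(2)[OF c0 t'] t by simp
    from order_tendstoD(1)[OF lim[OF t'] this] inS
    show "\<forall>\<^sub>F p in at p0 within ?S. radius (fst p) (snd p) < a"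
    proof eventually_elim
      case (elim p)
      then have "radius (fst p) (snd p) < t" using less_radius_iff(2)[OF _ t', of "fst p" "snd p"] by auto
      then show ?case using t by simp
    qed
  qed
qed

lemma continuous_on_radius_angle:
  assumes "c \<in> {I 0<..<C}"
  shows "continuous_on UNIV (radius c)"
proof -
  have "continuous_on UNIV (\<lambda>\<theta>. radius (fst (c, \<theta>)) (snd (c, \<theta>)))"
    by (rule continuous_on_compose2[OF continuous_on_radius]) (use assms in \<open>auto intro!: continuous_intros\<close>)
  then show ?thesis by simp
qed

lemma continuous_on_curve_angle: "c \<in> {I 0<..<C} \<Longrightarrow> continuous_on UNIV (curve c)"
  unfolding curve_def[abs_def] by (intro continuous_intros continuous_on_radius_angle)

lemma continuous_on_curve_level: "continuous_on {I 0<..<C} (\<lambda>c. curve c \<theta>)"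
  unfolding curve_def
proof (intro continuous_intros)
  have "continuous_on {I 0<..<C} (\<lambda>c. radius (fst (c, \<theta>)) (snd (c, \<theta>)))"
    by (rule continuous_on_compose2[OF continuous_on_radius]) (auto intro!: continuous_intros)
  then show "continuous_on {I 0<..<C} (\<lambda>c. radius c \<theta>)" by simp
qed

lemma curve_in_A: "c \<in> {I 0<..<C} \<Longrightarrow> curve c \<theta> \<in> A"
  using radius[of c \<theta>] by (auto simp: A_iff curve_def norm_mult)

lemma curve_nonzero: "c \<in> {I 0<..<C} \<Longrightarrow> curve c \<theta> \<noteq> 0"
  using radius(1)[of c \<theta>] by (auto simp: curve_def)

lemma curve_eqI:
  assumes "z \<in> A" "z \<noteq> 0" "z = of_real (norm z) * cis (2 * pi * \<theta>)"
  shows "I z \<in> {I 0<..<C}" "curve (I z) \<theta> = z"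
proof -
  show "I z \<in> {I 0<..<C}" using assms I_min[of z] by (auto simp: A_iff)
  then have "radius (I z) \<theta> = norm z"
    by (rule radius_eqI) (use assms in \<open>auto simp: A_iff\<close>)
  then show "curve (I z) \<theta> = z" using assms(3) by (simp add: curve_def)
qed

lemma curve_onto:
  assumes "z \<in> A" "z \<noteq> 0"
  obtains \<theta> where "I z \<in> {I 0<..<C}" "curve (I z) \<theta> = z"
proof -
  have "z = of_real (norm z) * cis (2 * pi * (Arg z / (2 * pi)))"
    using polar[OF assms(2)] cis_Arg[OF assms(2)] by simp
  from curve_eqI[OF assms this] that show ?thesis by blast
qed

lemma cis_add_1: "cis (2 * pi * (\<theta> + 1)) = cis (2 * pi * \<theta>)"
  by (simp add: distrib_left flip: cis_mult)

lemma curve_add_1: "curve c (\<theta> + 1) = curve c \<theta>"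
  by (simp add: curve_def radius_def cis_add_1)

lemma curve_eq_imp:
  assumes "c \<in> {I 0<..<C}" "curve c \<theta> = curve c \<theta>'"
  shows "\<exists>k. \<theta> = \<theta>' + of_int k"
proof -
  have "radius c \<theta> = radius c \<theta>'"
    using arg_cong[OF assms(2), of norm] radius(1)[OF assms(1), of \<theta>] radius(1)[OF assms(1), of \<theta>']
    by (simp add: curve_def norm_mult)
  then have "cis (2 * pi * \<theta>) = cis (2 * pi * \<theta>')"
    using assms(2) radius(1)[OF assms(1), of \<theta>] by (simp add: curve_def)
  then have "sin (2 * pi * \<theta>) = sin (2 * pi * \<theta>') \<and> cos (2 * pi * \<theta>) = cos (2 * pi * \<theta>')"
    by (simp add: complex_eq_iff)
  then obtain n :: int where "2 * pi * \<theta> = 2 * pi * \<theta>' + 2 * pi * n"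
    using sin_cos_eq_iff by blast
  then have "2 * pi * \<theta> = 2 * pi * (\<theta>' + of_int n)" by (simp add: distrib_left)
  then have "\<theta> = \<theta>' + of_int n" by (subst (asm) mult_cancel_left) simp
  then show ?thesis by blast
qed

text \<open>
  The principal argument is continuous here, because \<open>near_rotation\<close> keeps the quotient in the right
  half-plane.
\<close>

definition lift :: "real \<Rightarrow> real \<Rightarrow> real" where
  "lift c \<theta> = \<theta> + \<omega> + Arg (f (curve c \<theta>) / (cis (2 * pi * \<omega>) * curve c \<theta>)) / (2 * pi)"

text \<open>By \<open>near_rotation\<close> the quotient lies within distance less than 1 of the
  point 1.\<close>

lemma quotient_Re_pos:
  assumes "z \<in> A" "z \<noteq> 0"
  shows "0 < Re (f z / (cis (2 * pi * \<omega>) * z))"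
proof -
  define q where "q = f z / (cis (2 * pi * \<omega>) * z)"
  have "q - 1 = (f z - cis (2 * pi * \<omega>) * z) / (cis (2 * pi * \<omega>) * z)"
    using assms by (simp add: q_def diff_divide_distrib)
  then have "norm (q - 1) < 1"
    using near_rotation[OF assms] assms by (simp add: norm_divide norm_mult)
  then have "Re (1 - q) < 1" using complex_Re_le_cmod[of "1 - q"] by (simp add: norm_minus_commute)
  then show ?thesis by (simp add: q_def)
qed

text \<open>Only the angle has to be computed: the image has the same value of \<open>I\<close>, and
  level and angle together determine the point.\<close>

lemma f_curve:
  assumes c: "c \<in> {I 0<..<C}"
  shows "f (curve c \<theta>) = curve c (lift c \<theta>)"
proof -
  define z where "z = curve c \<theta>"
  have z: "z \<in> A" "z \<noteq> 0" using curve_in_A curve_nonzero c by (auto simp: z_def)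
  define q where "q = f z / (cis (2 * pi * \<omega>) * z)"
  have "0 < Re q" using quotient_Re_pos[OF z] by (simp add: q_def)
  then have q: "q \<noteq> 0" by auto
  have fz: "f z = q * (cis (2 * pi * \<omega>) * z)" using z by (simp add: q_def)
  have z_polar: "z = of_real (norm z) * cis (2 * pi * \<theta>)"
    using radius(1)[OF c, of \<theta>] by (simp add: z_def curve_def norm_mult)
  have "q = of_real (norm q) * cis (Arg q)" using polar[OF q] cis_Arg[OF q] by simp
  then have "f z = of_real (norm q) * cis (Arg q) * (cis (2 * pi * \<omega>) * (of_real (norm z) * cis (2 * pi * \<theta>)))"
    using fz z_polar by metis
  also have "\<dots> = of_real (norm q * norm z) * (cis (Arg q) * cis (2 * pi * \<omega>) * cis (2 * pi * \<theta>))"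
    by simp
  also have "cis (Arg q) * cis (2 * pi * \<omega>) * cis (2 * pi * \<theta>) = cis (2 * pi * lift c \<theta>)"
    by (simp add: cis_mult lift_def q_def z_def distrib_left add_ac)
  also have "norm q * norm z = norm (f z)" using fz by (simp add: norm_mult)
  finally have "f z = of_real (norm (f z)) * cis (2 * pi * lift c \<theta>)" .
  moreover have "f z \<noteq> 0" using fz q z by auto
  ultimately have "curve (I (f z)) (lift c \<theta>) = f z" by (intro curve_eqI f_in_A z)
  moreover have "I (f z) = c" using I_f[OF z(1)] radius(3)[OF c] by (simp add: z_def)
  ultimately show ?thesis by (simp add: z_def)
qed

lemma funpow_f_curve:
  assumes c: "c \<in> {I 0<..<C}"
  shows "(f ^^ n) (curve c \<theta>) = curve c ((lift c ^^ n) \<theta>)"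
  by (induction n) (auto simp: f_curve[OF c])

lemma lift_add_1: "lift c (\<theta> + 1) = lift c \<theta> + 1"
  by (simp add: lift_def curve_add_1)

lemma continuous_on_lift:
  assumes c: "c \<in> {I 0<..<C}"
  shows "continuous_on UNIV (lift c)"
proof -
  have "isCont (lift c) \<theta>" for \<theta>
  proof -
    have curve: "isCont (curve c) \<theta>"
      using continuous_on_curve_angle[OF c] by (simp add: continuous_on_eq_continuous_at)
    have z: "curve c \<theta> \<in> A" "curve c \<theta> \<noteq> 0" using curve_in_A curve_nonzero c by auto
    have "isCont (\<lambda>\<theta>. f (curve c \<theta>)) \<theta>"
      using z A_subset by (intro isCont_o2[OF curve] f_isCont) auto
    then have "isCont (\<lambda>\<theta>. f (curve c \<theta>) / (cis (2 * pi * \<omega>) * curve c \<theta>)) \<theta>"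
      using z by (intro continuous_intros curve) auto
    moreover have "f (curve c \<theta>) / (cis (2 * pi * \<omega>) * curve c \<theta>) \<notin> \<real>\<^sub>\<le>\<^sub>0"
      using quotient_Re_pos[OF z] by (auto simp: complex_nonpos_Reals_iff)
    ultimately have "isCont (\<lambda>\<theta>. Arg (f (curve c \<theta>) / (cis (2 * pi * \<omega>) * curve c \<theta>))) \<theta>"
      by (intro isCont_o2[OF _ continuous_at_Arg])
    then show ?thesis unfolding lift_def[abs_def] by (intro continuous_intros) auto
  qed
  then show ?thesis by (intro continuous_at_imp_continuous_on) auto
qed

text \<open>A continuous injective function on the line is monotone, and \<open>lift_add_1\<close>
  excludes the decreasing case.\<close>

lemma strict_mono_lift:
  assumes c: "c \<in> {I 0<..<C}"
  shows "strict_mono (lift c)"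
proof (rule strict_monoI)
  have lift_int: "lift c (\<theta> + of_int k) = lift c \<theta> + of_int k" for \<theta> k
    by (rule lift_of_int) (rule lift_add_1)
  have "inj (lift c)"
  proof (rule injI)
    fix x y assume eq: "lift c x = lift c y"
    then have "f (curve c x) = f (curve c y)" by (simp add: f_curve[OF c])
    then have "curve c x = curve c y" using inj curve_in_A[OF c] by (auto dest: inj_onD)
    \<comment> \<open>An integer difference \<open>k\<close> of the angles reappears as a difference
      of the lifts, so it is 0.\<close>
    then obtain k where "x = y + of_int k" using curve_eq_imp[OF c] by blast
    then show "x = y" using eq lift_int[of y k] by simp
  qed
  fix x y :: real assume "x < y"
  \<comment> \<open>Some integer translate of \<open>x\<close> lies beyond \<open>y\<close>; between
    \<open>x\<close> and this translate the lift is known to gain \<open>k\<close>, which settles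
    the direction of monotonicity.\<close>
  define k where "k = \<lfloor>y - x\<rfloor> + 1"
  have k: "y < x + of_int k" unfolding k_def by linarith
  have "lift c x < lift c (x + of_int k)" using k \<open>x < y\<close> unfolding lift_int by linarith
  moreover have "(lift c x < lift c y \<and> lift c y < lift c (x + of_int k))
      \<or> (lift c (x + of_int k) < lift c y \<and> lift c y < lift c x)"
    using \<open>x < y\<close> k continuous_on_subset[OF continuous_on_lift[OF c]] inj_on_subset[OF \<open>inj (lift c)\<close>]
    by (intro continuous_inj_imp_mono) auto
  ultimately show "lift c x < lift c y" by linarith
qed

section \<open>Analyticity along levels and periodic points\<close>

lemma analytic_curve_radius:
  assumes c: "c \<in> {I 0<..<C}"
  shows "analytic_curve (\<lambda>\<theta>. of_real (radius c \<theta>)) \<theta>"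
proof (rule polar_level_set_analytic[where I = I and c = c])
  show "real_analytic_at I (of_real (radius c \<theta>) * cis (2 * pi * \<theta>))"
    using an_I[OF subsetD[OF A_subset curve_in_A[OF c]]] by (simp add: curve_def)
  show "isCont (radius c) \<theta>"
    using continuous_on_radius_angle[OF c] by (simp add: continuous_on_eq_continuous_at)
  show "I (of_real (radius c \<theta>) * cis (2 * pi * \<theta>)) = c" for \<theta>
    using radius(3)[OF c] by (simp add: curve_def)
  show "((\<lambda>t. I (of_real t * cis (2 * pi * \<theta>))) has_real_derivative
      DI (of_real (radius c \<theta>) * cis (2 * pi * \<theta>)) (cis (2 * pi * \<theta>))) (at (radius c \<theta>))"
    using radius[OF c, of \<theta>] by (intro I_ray_derivative) (simp add: norm_mult)
  show "DI (of_real (radius c \<theta>) * cis (2 * pi * \<theta>)) (cis (2 * pi * \<theta>)) \<noteq> 0"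
    using DI_ray_pos[of "cis (2 * pi * \<theta>)" "radius c \<theta>"] radius[OF c, of \<theta>] by simp
qed

lemma analytic_curve_curve:
  assumes c: "c \<in> {I 0<..<C}"
  shows "analytic_curve (curve c) \<theta>"
proof -
  have "analytic_curve (\<lambda>\<theta>. exp (\<i> * of_real (2 * pi) * of_real \<theta>)) \<theta>"
    by (rule analytic_curve_of_entire) (intro holomorphic_intros)
  then have "analytic_curve (\<lambda>\<theta>. cis (2 * pi * \<theta>)) \<theta>" by (simp add: cis_conv_exp mult.assoc)
  then show ?thesis unfolding curve_def[abs_def] by (intro analytic_curve_mult analytic_curve_radius c)
qed

lemma analytic_curve_funpow_f:
  assumes "analytic_curve z t" "z t \<in> A"
  shows "analytic_curve (\<lambda>x. (f ^^ n) (z x)) t"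
proof (induction n)
  case (Suc n)
  have "real_analytic_at f ((f ^^ n) (z t))"
    using funpow_f_in_A[OF assms(2), of n] A_subset by (intro an_f) auto
  then show ?case using analytic_curve_compose[OF _ Suc] by simp
qed (use assms in simp)

lemma funpow_f_derivative:
  "(f ^^ n) 0 = 0 \<and> ((f ^^ n) has_derivative (\<lambda>z. cis (2 * pi * \<omega>) ^ n * z)) (at 0)"
proof (induction n)
  case (Suc n)
  have "(f has_derivative (\<lambda>z. cis (2 * pi * \<omega>) * z)) (at ((f ^^ n) 0))" using Suc der0 by simp
  then have "((\<lambda>x. f ((f ^^ n) x)) has_derivative
      (\<lambda>z. cis (2 * pi * \<omega>) * (cis (2 * pi * \<omega>) ^ n * z))) (at 0)"
    by (rule has_derivative_compose[OF conjunct2[OF Suc]])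
  then show ?case using Suc f0 by (simp add: o_def mult.assoc)
qed (simp add: id_def)

lemma multiplier_power_ne_1:
  assumes "q > 0"
  shows "cis (2 * pi * \<omega>) ^ q \<noteq> 1"
proof
  assume "cis (2 * pi * \<omega>) ^ q = 1"
  then have "Re (cis (real q * (2 * pi * \<omega>))) = Re 1" using Complex.DeMoivre by metis
  then have "cos (real q * (2 * pi * \<omega>)) = 1" by (simp only: cis.sel one_complex.sel)
  then obtain n :: int where "real q * (2 * pi * \<omega>) = of_int n * 2 * pi"
    using cos_one_2pi_int by blast
  then have "real q * \<omega> = of_int n" by simp
  then have "\<omega> = of_int n / of_nat q" using assms by (simp add: field_simps)
  then show False using irrational by simp
qed

lemma countable_periodic_on_axis:
  assumes "q > 0"
  shows "countable {t. of_real t \<in> A \<and> (f ^^ q) (of_real t) = of_real t}"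
proof (rule ccontr)
  assume unc: "uncountable {t. of_real t \<in> A \<and> (f ^^ q) (of_real t) = of_real t}"
  define S where "S = {t :: real. complex_of_real t * 1 \<in> A}"
  have S: "open S" "connected S" "0 \<in> S" unfolding S_def by (rule line_open_connected)+
  have "analytic_curve (\<lambda>t. (f ^^ q) (of_real t) - of_real t) t" if "t \<in> S" for t
    using that by (intro analytic_curve_diff analytic_curve_funpow_f analytic_curve_of_real) (simp add: S_def)
  moreover have "uncountable {t \<in> S. (f ^^ q) (of_real t) - of_real t = 0}"
    using unc by (simp add: S_def)
  ultimately have id: "(f ^^ q) (of_real t) - of_real t = 0" if "t \<in> S" for t
    by (rule analytic_curve_zeros[OF _ S(1,2) _ that])
  \<comment> \<open>The origin belongs to the interval \<open>S\<close>, so the derivative of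
    \<open>f ^^ q\<close> along the axis can be compared with that of the identity at 0.\<close>
  have "((\<lambda>t. complex_of_real t) has_derivative of_real) (at 0)"
    by (auto intro!: derivative_eq_intros)
  then have "((\<lambda>t. (f ^^ q) (of_real t)) has_derivative (\<lambda>t. cis (2 * pi * \<omega>) ^ q * of_real t)) (at 0)"
    by (rule has_derivative_compose) (use funpow_f_derivative in simp)
  then have "((\<lambda>t. complex_of_real t) has_derivative (\<lambda>t. cis (2 * pi * \<omega>) ^ q * of_real t)) (at 0)"
    by (rule has_derivative_transform_within_open[OF _ S(1,3)]) (use id in auto)
  then have "(\<lambda>t. cis (2 * pi * \<omega>) ^ q * of_real t) = of_real"
    using \<open>((\<lambda>t. complex_of_real t) has_derivative of_real) (at 0)\<close> by (rule has_derivative_unique)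
  then have "cis (2 * pi * \<omega>) ^ q = 1" by (metis mult.right_neutral of_real_1)
  then show False using multiplier_power_ne_1[OF assms] by blast
qed

lemma invariant_const_on_generic_level:
  fixes h :: "complex \<Rightarrow> real"
  assumes c: "c \<in> {I 0<..<C}" and h: "continuous_on A h" "\<And>z. z \<in> A \<Longrightarrow> h (f z) = h z"
    and generic: "\<And>q. q > 0 \<Longrightarrow> (f ^^ q) (curve c 0) \<noteq> curve c 0"
  shows "h (curve c \<theta>) = h (curve c \<theta>')"
proof (rule invariant_const_of_countable_periodic_points[where F = "lift c" and h = "\<lambda>\<theta>. h (curve c \<theta>)"])
  show "continuous_on UNIV (lift c)" "strict_mono (lift c)"
    using continuous_on_lift[OF c] strict_mono_lift[OF c] .
  show "lift c (x + 1) = lift c x + 1" for x by (rule lift_add_1)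
  show "continuous_on UNIV (\<lambda>\<theta>. h (curve c \<theta>))"
    by (rule continuous_on_compose2[OF h(1) continuous_on_curve_angle[OF c]]) (use curve_in_A[OF c] in auto)
  show "h (curve c (x + 1)) = h (curve c x)" for x by (simp add: curve_add_1)
  show "h (curve c (lift c x)) = h (curve c x)" for x
    using h(2)[OF curve_in_A[OF c]] by (simp add: f_curve[OF c])
  show "countable {x. (lift c ^^ q) x = x + of_int p}" if "q > 0" for q p
  proof (rule ccontr)
    assume unc: "uncountable {x. (lift c ^^ q) x = x + of_int p}"
    have per: "curve c (x + of_int k) = curve c x" for x k
      by (rule periodic_of_int) (rule curve_add_1)
    \<comment> \<open>The displacement \<open>p\<close> disappears on the closed curve, so these
      angles are zeros of one analytic curve whatever \<open>p\<close> is.\<close>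
    have "{x. (lift c ^^ q) x = x + of_int p} \<subseteq> {x \<in> UNIV. (f ^^ q) (curve c x) - curve c x = 0}"
      by (auto simp: funpow_f_curve[OF c] per)
    then have "uncountable {x \<in> UNIV. (f ^^ q) (curve c x) - curve c x = 0}"
      using unc countable_subset by blast
    then have "(f ^^ q) (curve c 0) - curve c 0 = 0"
      by (intro analytic_curve_zeros[where S = UNIV]) (auto intro!: analytic_curve_diff analytic_curve_funpow_f analytic_curve_curve curve_in_A c)
    then show False using generic[OF that] by simp
  qed
qed

lemma invariant_const_on_level:
  fixes h :: "complex \<Rightarrow> real"
  assumes h: "continuous_on A h" "\<And>z. z \<in> A \<Longrightarrow> h (f z) = h z" and c: "c \<in> {I 0<..<C}"
  shows "h (curve c \<theta>) = h (curve c 0)"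
proof -
  \<comment> \<open>The exceptional levels: values of \<open>I\<close> at periodic points of the
    real axis, countably many for each period. For a fixed angle the difference of the two values of
    \<open>h\<close> is continuous in the level, so it suffices that it vanishes off
    \<open>B\<close>.\<close>
  define B where "B = (\<lambda>t. I (of_real t)) ` (\<Union>q\<in>{0<..}. {t. of_real t \<in> A \<and> (f ^^ q) (of_real t) = of_real t})"
  have "h (curve c \<theta>) - h (curve c 0) = 0"
  proof (rule countable_zero_exceptions[where B = B and a = "I 0" and b = C and x = c
        and D = "\<lambda>c. h (curve c \<theta>) - h (curve c 0)"])
    show "continuous_on {I 0<..<C} (\<lambda>c. h (curve c \<theta>) - h (curve c 0))"
      by (intro continuous_on_diff; rule continuous_on_compose2[OF h(1) continuous_on_curve_level];
          use curve_in_A in blast)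
    show "countable B"
      unfolding B_def by (intro countable_image countable_UN countable_periodic_on_axis) auto
    fix c assume c: "c \<in> {I 0<..<C}" and "c \<notin> B"
    have "(f ^^ q) (curve c 0) \<noteq> curve c 0" if "q > 0" for q
    proof
      assume "(f ^^ q) (curve c 0) = curve c 0"
      moreover have "curve c 0 = of_real (radius c 0)" by (simp add: curve_def)
      ultimately have "I (of_real (radius c 0)) \<in> B"
        using that curve_in_A[OF c, of 0] by (auto simp: B_def)
      then show False using \<open>c \<notin> B\<close> radius(3)[OF c, of 0] by (simp add: curve_def)
    qed
    then show "h (curve c \<theta>) - h (curve c 0) = 0"
      using invariant_const_on_generic_level[OF c h] by simp
  qed (rule c)
  then show ?thesis by simp
qed

section \<open>Invariant functions and their differentials\<close>

lemma invariant_function_of_I: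
  fixes h :: "complex \<Rightarrow> real"
  assumes h: "continuous_on A h" "\<And>z. z \<in> A \<Longrightarrow> h (f z) = h z"
    and z: "z \<in> A" "w \<in> A" "I z = I w"
  shows "h z = h w"
proof (cases "z = 0 \<or> w = 0")
  case True
  then have "z = w" using I_min[of z] I_min[of w] z A_subset by (metis less_irrefl subsetD)
  then show ?thesis by simp
next
  case False
  then have "z \<noteq> 0" "w \<noteq> 0" by auto
  obtain \<theta> where "I z \<in> {I 0<..<C}" "curve (I z) \<theta> = z"
    by (rule curve_onto[OF z(1) \<open>z \<noteq> 0\<close>]) (rule that)
  moreover obtain \<theta>' where "curve (I w) \<theta>' = w"
    by (rule curve_onto[OF z(2) \<open>w \<noteq> 0\<close>]) (rule that)
  ultimately have "I z \<in> {I 0<..<C}" "curve (I z) \<theta> = z" "curve (I z) \<theta>' = w"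
    using z(3) by simp_all
  then show ?thesis using invariant_const_on_level[OF h, of "I z"] by metis
qed

text \<open>The tangent of the level at \<open>z\<close> is \<open>z\<close> times k + 2 pi i, where
  \<open>k\<close> is the logarithmic derivative of the radius with respect to the angle. The order
  of quantifiers matters: one \<open>k\<close> serves all invariant functions, in particular
  \<open>I\<close> and a second integral.\<close>

lemma invariant_derivative_tangent:
  assumes z: "z \<in> A" "z \<noteq> 0"
  shows "\<exists>k. \<forall>h Dh. continuous_on A h \<longrightarrow> (\<forall>z\<in>A. h (f z) = h z) \<longrightarrow> (h has_derivative Dh) (at z) \<longrightarrow>
    Dh (Complex k (2 * pi) * z) = (0 :: real)"
proof -
  obtain \<theta> where c: "I z \<in> {I 0<..<C}" and \<theta>: "curve (I z) \<theta> = z"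
    by (rule curve_onto[OF z]) (rule that)
  obtain e where e: "((\<lambda>\<theta>. complex_of_real (radius (I z) \<theta>)) has_vector_derivative e) (at \<theta>)"
    using analytic_curve_has_vector_derivative[OF analytic_curve_radius[OF c]] by blast
  from bounded_linear.has_vector_derivative[OF bounded_linear_Re e]
  have r: "(radius (I z) has_real_derivative Re e) (at \<theta>)"
    by (simp add: has_real_derivative_iff_has_vector_derivative)
  define k where "k = Re e / radius (I z) \<theta>"
  have "((\<lambda>\<theta>. cis (2 * pi * \<theta>)) has_vector_derivative (2 * pi) *\<^sub>R (\<i> * cis (2 * pi * \<theta>))) (at \<theta>)"
  proof -
    have "((\<lambda>z. exp (\<i> * (2 * pi) * z)) has_field_derivative \<i> * (2 * pi) * exp (\<i> * (2 * pi) * of_real \<theta>)) (at (of_real \<theta>))"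
      by (auto intro!: derivative_eq_intros)
    from has_vector_derivative_real_field[OF this] show ?thesis
      by (simp add: cis_conv_exp scaleR_conv_of_real mult_ac)
  qed
  from has_vector_derivative_mult[OF has_vector_derivative_of_real[OF r] this]
  have "(curve (I z) has_vector_derivative
      of_real (radius (I z) \<theta>) * ((2 * pi) *\<^sub>R (\<i> * cis (2 * pi * \<theta>))) + of_real (Re e) * cis (2 * pi * \<theta>)) (at \<theta>)"
    by (simp add: curve_def[abs_def])
  also have "of_real (radius (I z) \<theta>) * ((2 * pi) *\<^sub>R (\<i> * cis (2 * pi * \<theta>))) + of_real (Re e) * cis (2 * pi * \<theta>)
      = Complex k (2 * pi) * z"
    using radius(1)[OF c, of \<theta>]
    by (subst (2) \<theta>[symmetric]) (simp add: curve_def k_def Complex_eq scaleR_conv_of_real algebra_simps)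
  finally have der: "(curve (I z) has_derivative (\<lambda>s. s *\<^sub>R (Complex k (2 * pi) * z))) (at \<theta>)"
    by (simp add: has_vector_derivative_def)
  show ?thesis
  proof (intro exI[of _ k] allI impI)
    fix h :: "complex \<Rightarrow> real" and Dh
    assume h: "continuous_on A h" "\<forall>z\<in>A. h (f z) = h z" and Dh: "(h has_derivative Dh) (at z)"
    have "((\<lambda>\<theta>. h (curve (I z) \<theta>)) has_derivative (\<lambda>s. Dh (s *\<^sub>R (Complex k (2 * pi) * z)))) (at \<theta>)"
      by (rule has_derivative_compose[OF der]) (use Dh \<theta> in simp)
    moreover have "(\<lambda>\<theta>. h (curve (I z) \<theta>)) = (\<lambda>_. h (curve (I z) 0))"
      using invariant_const_on_level[OF h(1) _ c] h(2) by (intro ext) auto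
    ultimately have "((\<lambda>_. h (curve (I z) 0)) has_derivative (\<lambda>s. Dh (s *\<^sub>R (Complex k (2 * pi) * z)))) (at \<theta>)"
      by simp
    from has_derivative_unique[OF this has_derivative_const]
    show "Dh (Complex k (2 * pi) * z) = 0" by (metis scaleR_one)
  qed
qed

text \<open>Both differentials vanish on the tangent of the level, so they are proportional, and
  their values on the transversal vector \<open>z\<close> give the ratio.\<close>

lemma invariant_derivative_parallel:
  fixes h :: "complex \<Rightarrow> real"
  assumes z: "z \<in> A" "z \<noteq> 0"
    and h: "continuous_on A h" "\<And>z. z \<in> A \<Longrightarrow> h (f z) = h z" and Dh: "(h has_derivative Dh) (at z)"
  shows "DI z z * Dh v = Dh z * DI z v"
proof -
  have I: "(I has_derivative DI z) (at z)" using z A_subset by (intro I_has_derivative) auto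
  obtain k where k: "\<And>h Dh. continuous_on A h \<Longrightarrow> \<forall>z\<in>A. h (f z) = h z \<Longrightarrow> (h has_derivative Dh) (at z) \<Longrightarrow>
    Dh (Complex k (2 * pi) * z) = (0 :: real)"
    using invariant_derivative_tangent[OF z] by blast
  have 0: "DI z (Complex k (2 * pi) * z) = 0" "Dh (Complex k (2 * pi) * z) = 0"
    using k[OF continuous_on_subset[OF continuous_on_I A_subset] _ I] k[OF h(1) _ Dh] I_f h(2) by auto
  \<comment> \<open>Coordinates of \<open>v\<close> in the real basis formed by \<open>z\<close> and
    the tangent vector; division by \<open>z\<close> reduces them to real and imaginary
    parts.\<close>
  define b where "b = Im (v / z) / (2 * pi)"
  define a where "a = Re (v / z) - k * b"
  have "v / z = of_real a + of_real b * Complex k (2 * pi)"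
    by (simp add: complex_eq_iff a_def b_def)
  then have "v = a *\<^sub>R z + b *\<^sub>R (Complex k (2 * pi) * z)"
    using z(2) by (simp add: field_simps scaleR_conv_of_real)
  then have "DI z v = a * DI z z" "Dh v = a * Dh z"
    using has_derivative_linear[OF I] has_derivative_linear[OF Dh] 0
    by (simp_all add: linear_add linear_scale)
  then show ?thesis by simp
qed

end

section \<open>Second integrals\<close>

lemma linear_coordinates:
  fixes L :: "complex \<Rightarrow> real"
  assumes "linear L"
  shows "L v = Re v * L 1 + Im v * L \<i>"
proof -
  have "v = Re v *\<^sub>R 1 + Im v *\<^sub>R \<i>" by (simp add: complex_eq_iff)
  then have "L v = L (Re v *\<^sub>R 1 + Im v *\<^sub>R \<i>)" by simp
  then show ?thesis using assms by (simp add: linear_add linear_scale)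
qed

context elliptic_integral
begin

text \<open>Lowering the level alone, with \<rho> kept, is the means of avoiding the zeros of a
  denominator without constructing the whole setting again.\<close>

lemma shrink:
  assumes "I 0 < C'" "C' \<le> C"
  shows "elliptic_integral I \<rho> f C' \<omega>"
proof -
  have sub: "sublevel_disc I \<rho> C' \<subseteq> A" using assms by (auto simp: sublevel_disc_def)
  show ?thesis
  proof (unfold_locales)
    show "\<exists>t. 0 < t \<and> t < \<rho> \<and> C' \<le> I (of_real t * w)" if "norm w = 1" for w
      using reach[OF that] assms by force
    show "inj_on f (sublevel_disc I \<rho> C')" using inj_on_subset[OF inj sub] .
  qed (use assms sub an_f f_disc near_rotation f0 der0 irrational in auto)
qed

lemma differentiable_not_independent:
  assumes diff: "\<And>z. z \<in> A \<Longrightarrow> h differentiable (at z)" and inv: "first_integral_on f A h"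
    and W: "W \<subseteq> A - {0}" "W \<noteq> {}"
  shows "\<not> differentials_independent_on I h W"
proof
  assume ind: "differentials_independent_on I h W"
  obtain z where z: "z \<in> W" "z \<in> A" "z \<noteq> 0" using W by blast
  have "continuous_on A h"
    using diff by (intro continuous_at_imp_continuous_on) (auto intro: differentiable_imp_continuous_within)
  moreover have "h (f z) = h z" if "z \<in> A" for z
    using inv that f_in_A by (auto simp: first_integral_on_def)
  ultimately have "DI z z * frechet_derivative h (at z) v = frechet_derivative h (at z) z * DI z v" for v
    using invariant_derivative_parallel[OF z(2,3)] diff[OF z(2)] frechet_derivative_works by blast
  \<comment> \<open>In this dependence relation the coefficient of the second differential is
    \<open>DI z z\<close>, which is positive off the origin.\<close>
  then have "\<forall>v. - frechet_derivative h (at z) z * DI z v + DI z z * frechet_derivative h (at z) v = 0"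
    by simp
  then have "DI z z = 0" using ind z(1) unfolding differentials_independent_on_def by blast
  then show False using radial[of z] z A_subset by force
qed

lemma continuous_not_independent:
  assumes cont: "continuous_on A h" and inv: "first_integral_on f A h"
    and W: "open W" "W \<subseteq> A" "W \<noteq> {}"
  shows "\<not> continuously_independent_on I h W"
proof -
  \<comment> \<open>A representative of the level is chosen arbitrarily; no regularity is asked of
    \<open>H\<close>.\<close>
  define H where "H y = h (SOME z. z \<in> A \<and> I z = y)" for y
  have inv': "h (f z) = h z" if "z \<in> A" for z
    using inv that f_in_A by (auto simp: first_integral_on_def)
  have "h z = H (I z)" if "z \<in> A" for z
  proof -
    have "(SOME w. w \<in> A \<and> I w = I z) \<in> A \<and> I (SOME w. w \<in> A \<and> I w = I z) = I z"
      by (rule someI[of _ z]) (use that in simp)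
    then show ?thesis unfolding H_def using invariant_function_of_I[OF cont inv' that] by metis
  qed
  then show ?thesis unfolding continuously_independent_on_def using W by blast
qed

lemma analytic_vanishing_on_line:
  fixes g :: "real \<Rightarrow> complex"
  assumes an: "\<And>t. of_real t * z \<in> A \<Longrightarrow> analytic_curve g t"
    and ab: "a < b" "\<And>t. a < t \<Longrightarrow> t < b \<Longrightarrow> of_real t * z \<in> A \<and> g t = 0"
    and t: "of_real t * z \<in> A"
  shows "g t = 0"
proof (rule analytic_curve_zeros[where S = "{t. of_real t * z \<in> A}"])
  have "{a<..<b} \<subseteq> {t \<in> {t. of_real t * z \<in> A}. g t = 0}" using ab by auto
  then show "uncountable {t \<in> {t. of_real t * z \<in> A}. g t = 0}"
    using uncountable_open_interval[of a b] ab(1) countable_subset by blast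
qed (use an t line_open_connected[of z] in auto)

lemma analytic_curve_line: "analytic_curve (\<lambda>t. of_real t * z) t"
  by (intro analytic_curve_mult analytic_curve_of_real analytic_curve_const)

text \<open>An open set of zeros would meet a line through 0 in an interval, and analyticity along
  the line would carry the zeros to 0. Hence the zeros of a denominator cannot fill
  \<open>W\<close>, and independence off them is never vacuous.\<close>

lemma analytic_nonzero_on_open:
  assumes Q: "real_analytic_on Q A" "Q 0 \<noteq> 0" and W: "open W" "W \<subseteq> A" "W \<noteq> {}"
  shows "\<exists>z\<in>W. Q z \<noteq> (0 :: real)"
proof (rule ccontr)
  assume "\<not> (\<exists>z\<in>W. Q z \<noteq> 0)"
  then have 0: "\<And>z. z \<in> W \<Longrightarrow> Q z = 0" by blast
  obtain z where z: "z \<in> W" using W by blast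
  have "open ((\<lambda>t. of_real t * z) -` W)" by (intro open_vimage W continuous_intros)
  moreover have "1 \<in> (\<lambda>t. of_real t * z) -` W" using z by simp
  ultimately obtain e where e: "e > 0" "ball 1 e \<subseteq> (\<lambda>t. of_real t * z) -` W"
    using openE by blast
  have tW: "of_real t * z \<in> W" if "1 < t" "t < 1 + e" for t
    using e(2) that by (auto simp: subset_iff dist_real_def)
  have "complex_of_real (Q (of_real 0 * z)) = 0"
  proof (rule analytic_vanishing_on_line[where g = "\<lambda>t. of_real (Q (of_real t * z))" and t = 0
        and z = z and a = 1 and b = "1 + e"])
    show "analytic_curve (\<lambda>t. of_real (Q (of_real t * z))) t" if "of_real t * z \<in> A" for t
      using Q(1) that by (intro analytic_curve_compose_real analytic_curve_line) (auto simp: real_analytic_on_def)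
  qed (use e tW 0 W zero_in_A in auto)
  then show False using Q(2) by simp
qed

text \<open>\<open>K\<close> is the numerator of the quotient rule, the derivative of
  \<open>P / Q\<close> multiplied by the square of \<open>Q z\<close>; unlike that derivative it is
  analytic across the zeros of \<open>Q\<close>. Near the origin, where \<open>Q\<close> has no
  zeros, the argument by levels applies to \<open>P / Q\<close>, and the wedge is then followed
  outward along rays.\<close>

lemma meromorphic_wedge_zero:
  fixes P Q :: "complex \<Rightarrow> real"
  defines "K \<equiv> \<lambda>z v. frechet_derivative P (at z) v * Q z - P z * frechet_derivative Q (at z) v"
  assumes an: "real_analytic_on P A" "real_analytic_on Q A" and Q0: "Q 0 \<noteq> 0"
    and inv: "first_integral_on f {z \<in> A. Q z \<noteq> 0} (\<lambda>z. P z / Q z)" and z: "z \<in> A"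
  shows "DI z 1 * K z \<i> - DI z \<i> * K z 1 = 0"
proof -
  have dP: "(P has_derivative frechet_derivative P (at z)) (at z)"
    and dQ: "(Q has_derivative frechet_derivative Q (at z)) (at z)" if "z \<in> A" for z
    using an that by (auto simp: real_analytic_on_def intro: real_analytic_at_has_derivative)
  have "isCont Q 0" using has_derivative_continuous[OF dQ[OF zero_in_A]] .
  then obtain e where e: "e > 0" "\<And>z. dist z 0 < e \<Longrightarrow> Q z \<noteq> 0"
    using continuous_at_avoid[of 0 Q 0] Q0 by (metis dist_commute)
  \<comment> \<open>Below the level \<open>m\<close> the disc avoids the zeros of \<open>Q\<close>;
    the bound \<open>\<rho> / 2\<close> secures the strict inequality with \<rho>.\<close>
  obtain m where m: "I 0 < m" "sublevel_disc I \<rho> m \<subseteq> ball 0 (min e (\<rho> / 2))"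
  proof (rule sublevel_disc_small)
    show "0 < min e (\<rho> / 2)" "min e (\<rho> / 2) < \<rho>" using e(1) \<rho>_pos by auto
  qed (rule that)
  define C' where "C' = min m C"
  interpret small: elliptic_integral I \<rho> f C' \<omega>
    by (rule shrink) (use m I0_less in \<open>auto simp: C'_def\<close>)
  have sub: "small.A \<subseteq> A" by (auto simp: sublevel_disc_def C'_def)
  have Qnz: "Q z \<noteq> 0" if "z \<in> small.A" for z
  proof -
    have "z \<in> sublevel_disc I \<rho> m" using that by (auto simp: sublevel_disc_def C'_def)
    then have "dist z 0 < e" using m(2) by force
    then show ?thesis by (rule e(2))
  qed
  have dh: "((\<lambda>z. P z / Q z) has_derivative (\<lambda>v. K z v / (Q z * Q z))) (at z)" if "z \<in> small.A" for z
    unfolding K_def using has_derivative_divide'[OF dP dQ Qnz[OF that]] sub that by blast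
  have near: "DI z 1 * K z \<i> - DI z \<i> * K z 1 = 0" if "z \<in> small.A" "z \<noteq> 0" for z
  proof -
    have "DI z z * (K z v / (Q z * Q z)) = K z z / (Q z * Q z) * DI z v" for v
    proof (rule small.invariant_derivative_parallel[OF that _ _ dh[OF that(1)]])
      show "continuous_on small.A (\<lambda>z. P z / Q z)"
        using has_derivative_continuous[OF dh] by (intro continuous_at_imp_continuous_on) auto
      show "P (f z) / Q (f z) = P z / Q z" if "z \<in> small.A" for z
        using inv that small.f_in_A[OF that] sub Qnz by (auto simp: first_integral_on_def)
    qed
    then have par: "DI z z * K z v = K z z * DI z v" for v using Qnz[OF that(1)] by (simp add: field_simps)
    \<comment> \<open>The positive factor \<open>DI z z\<close> lets both terms of the wedge be
      rewritten by proportionality, after which they cancel.\<close>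
    have "DI z z * (DI z 1 * K z \<i> - DI z \<i> * K z 1) = DI z 1 * (DI z z * K z \<i>) - DI z \<i> * (DI z z * K z 1)"
      by (simp add: algebra_simps)
    also have "\<dots> = 0" unfolding par by simp
    finally show ?thesis using radial[of z] that small.A_subset by force
  qed
  define J where "J z = DI z 1 * K z \<i> - DI z \<i> * K z 1" for z
  have "complex_of_real (J (of_real 1 * z)) = 0"
  proof (cases "z = 0")
    case True
    \<comment> \<open>For \<open>z = 0\<close> the line degenerates to a point and nothing
      propagates; the wedge vanishes because 0 is a minimum of \<open>I\<close>.\<close>
    have I0: "DI 0 v = 0" for v
    proof -
      have "\<forall>\<^sub>F z in nhds 0. I 0 \<le> I z"
        using eventually_nhds_in_open[OF open_ball, of 0 0 \<rho>] \<rho>_pos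
        by (auto elim!: eventually_mono intro: order_less_imp_le dest!: I_min simp del: mem_ball)
      then have "DI 0 = (\<lambda>v. 0)"
        using I_has_derivative[of 0] \<rho>_pos
        by (intro has_derivative_local_min[of I "DI 0" 0]) (auto simp: eventually_nhds eventually_at_filter elim: eventually_mono)
      then show ?thesis by simp
    qed
    then show ?thesis using True by (simp add: J_def)
  next
    case False
    have "open {t. of_real t * z \<in> small.A}" "0 \<in> {t. of_real t * z \<in> small.A}"
      by (rule small.line_open_connected)+
    then obtain d where d: "d > 0" "ball 0 d \<subseteq> {t. of_real t * z \<in> small.A}" using openE by blast
    have tA: "of_real t * z \<in> small.A" if "0 < t" "t < d" for t
      using d(2) that by (auto simp: subset_iff dist_real_def)
    show ?thesis
    proof (rule analytic_vanishing_on_line[where g = "\<lambda>t. of_real (J (of_real t * z))" and t = 1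
          and z = z and a = 0 and b = d])
      show "0 < d" by fact
      show "of_real 1 * z \<in> A" using z by simp
      show "of_real t * z \<in> A \<and> complex_of_real (J (of_real t * z)) = 0" if "0 < t" "t < d" for t
        using tA[OF that] sub near[OF tA[OF that]] that False by (auto simp: J_def)
      fix t assume t: "of_real t * z \<in> A"
      have "real_analytic_at P (of_real t * z)" "real_analytic_at Q (of_real t * z)"
        "real_analytic_at I (of_real t * z)"
        using an t A_subset an_I by (auto simp: real_analytic_on_def)
      then show "analytic_curve (\<lambda>t. complex_of_real (J (of_real t * z))) t"
        unfolding J_def K_def of_real_diff of_real_mult[where 'a = complex]
        by (intro analytic_curve_diff analytic_curve_mult analytic_curve_compose_real real_analytic_at_frechet_derivative analytic_curve_line)
    qed
  qed
  then have "J z = 0" by (simp only: of_real_eq_0_iff of_real_1 mult_1)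
  then show ?thesis by (simp add: J_def)
qed

lemma meromorphic_not_independent:
  fixes P Q :: "complex \<Rightarrow> real"
  assumes an: "real_analytic_on P A" "real_analytic_on Q A" and Q0: "Q 0 \<noteq> 0"
    and inv: "first_integral_on f {z \<in> A. Q z \<noteq> 0} (\<lambda>z. P z / Q z)"
    and W: "open W" "W \<subseteq> A - {0}" "W \<noteq> {}"
  shows "\<not> differentials_independent_on I (\<lambda>z. P z / Q z) {z \<in> W. Q z \<noteq> 0}"
proof
  assume ind: "differentials_independent_on I (\<lambda>z. P z / Q z) {z \<in> W. Q z \<noteq> 0}"
  obtain z where z: "z \<in> W" "Q z \<noteq> 0"
    using analytic_nonzero_on_open[OF an(2) Q0 W(1)] W by blast
  then have zA: "z \<in> A" "z \<noteq> 0" using W by auto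
  define K where "K v = frechet_derivative P (at z) v * Q z - P z * frechet_derivative Q (at z) v" for v
  define Dh where "Dh v = K v / (Q z * Q z)" for v
  have "(P has_derivative frechet_derivative P (at z)) (at z)"
    "(Q has_derivative frechet_derivative Q (at z)) (at z)"
    using an zA by (auto simp: real_analytic_on_def intro: real_analytic_at_has_derivative)
  from has_derivative_divide'[OF this z(2)]
  have h: "((\<lambda>z. P z / Q z) has_derivative Dh) (at z)"
    by (simp add: Dh_def[abs_def] K_def)
  have "DI z 1 * K \<i> - DI z \<i> * K 1 = 0"
    unfolding K_def by (rule meromorphic_wedge_zero[OF an Q0 inv zA(1)])
  then have "DI z 1 * Dh \<i> - DI z \<i> * Dh 1 = 0"
    by (simp add: Dh_def flip: diff_divide_distrib)
  then have wedge: "DI z 1 * Dh \<i> = DI z \<i> * Dh 1" by simp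
  have I: "DI z v = Re v * DI z 1 + Im v * DI z \<i>" for v
    using has_derivative_linear[OF I_has_derivative] zA A_subset by (intro linear_coordinates) auto
  have D: "Dh v = Re v * Dh 1 + Im v * Dh \<i>" for v
    by (rule linear_coordinates[OF has_derivative_linear[OF h]])
  \<comment> \<open>The wedge of the two differentials on the pair \<open>z\<close>,
    \<open>v\<close> is its value on the standard basis times the determinant of \<open>z\<close>
    and \<open>v\<close>.\<close>
  have "- Dh z * DI z v + DI z z * Dh v
      = (Re z * Im v - Im z * Re v) * (DI z 1 * Dh \<i> - DI z \<i> * Dh 1)" for v
    unfolding I[of v] I[of z] D[of v] D[of z] by (simp add: algebra_simps)
  then have "\<forall>v. - Dh z * DI z v + DI z z * Dh v = 0" using wedge by simp
  moreover have "frechet_derivative (\<lambda>z. P z / Q z) (at z) = Dh"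
    using frechet_derivative_at[OF h] by simp
  ultimately have "DI z z = 0"
    using ind z unfolding differentials_independent_on_def by blast
  then show False using radial[of z] zA A_subset by force
qed

lemma no_independent_integral:
  assumes "open W" "W \<noteq> {}" "W \<subseteq> A - {0}"
  shows "\<not> has_independent_integral_on f I A W"
proof -
  have smooth: "h differentiable (at z)" if "smooth_on h A" "z \<in> A" for h z
    using that unfolding smooth_on_def by (metis C_on.simps(2))
  have analytic: "h differentiable (at z)" if "real_analytic_on h A" "z \<in> A"
    for z and h :: "complex \<Rightarrow> real"
    using that real_analytic_at_differentiable by (simp add: real_analytic_on_def)
  have W: "W \<subseteq> A" using assms by blast
  show ?thesis
    unfolding has_independent_integral_on_def
  proof (intro notI, elim disjE exE conjE)
    fix h assume "continuous_on A h" "first_integral_on f A h" "continuously_independent_on I h W"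
    then show False using continuous_not_independent[OF _ _ assms(1) W assms(2)] by blast
  next
    fix h assume "smooth_on h A" "first_integral_on f A h" "differentials_independent_on I h W"
    then show False using differentiable_not_independent[OF smooth _ assms(3,2)] by blast
  next
    fix P Q assume "real_analytic_on P A" "real_analytic_on Q A" "Q 0 \<noteq> 0"
      "first_integral_on f {z \<in> A. Q z \<noteq> 0} (\<lambda>z. P z / Q z)"
      "differentials_independent_on I (\<lambda>z. P z / Q z) {z \<in> W. Q z \<noteq> 0}"
    then show False using meromorphic_not_independent[OF _ _ _ _ assms(1,3,2)] by blast
  next
    fix h assume "real_analytic_on h A" "first_integral_on f A h" "differentials_independent_on I h W"
    then show False using differentiable_not_independent[OF analytic _ assms(3,2)] by blast
  qed
qed

end

section \<open>The local hypotheses at the elliptic point\<close>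

text \<open>The derivative at \<open>z\<close> in the direction \<open>z\<close> is the Hessian form
  plus an error of order o(|z|^2), and by compactness of the unit circle the form is at least a
  positive multiple of |z|^2.\<close>

lemma nondegenerate_min_radial:
  fixes I :: "complex \<Rightarrow> real"
  assumes an: "real_analytic_at I 0" and min: "nondegenerate_local_min I 0"
  shows "\<exists>r>0. \<forall>z. norm z < r \<longrightarrow> z \<noteq> 0 \<longrightarrow> 0 < frechet_derivative I (at z) z"
proof -
  obtain gx gy r where r: "r > 0" "real_analytic_at gx 0" "real_analytic_at gy 0"
    and der: "\<And>z. z \<in> ball 0 r \<Longrightarrow> (I has_derivative (\<lambda>v. Re v * gx z + Im v * gy z)) (at z)"
    by (rule real_analytic_at_partials[OF an]) (rule that)
  have DI: "frechet_derivative I (at z) v = Re v * gx z + Im v * gy z" if "z \<in> ball 0 r" for z v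
    using frechet_derivative_at[OF der[OF that]] by metis
  have "(\<lambda>v. Re v * gx 0 + Im v * gy 0) = (\<lambda>v. 0)"
    using has_derivative_unique[OF der[of 0]] r(1) min by (simp add: nondegenerate_local_min_def)
  from fun_cong[OF this, of 1] fun_cong[OF this, of \<i>] have g0: "gx 0 = 0" "gy 0 = 0" by simp_all
  define X where "X = frechet_derivative gx (at 0)"
  define Y where "Y = frechet_derivative gy (at 0)"
  have X: "(gx has_derivative X) (at 0)" and Y: "(gy has_derivative Y) (at 0)"
    using r by (auto simp: X_def Y_def intro: real_analytic_at_has_derivative)
  define q where "q v = Re v * X v + Im v * Y v" for v
  have "hessian I 0 v v = q v" for v
  proof -
    have "((\<lambda>z. Re v * gx z + Im v * gy z) has_derivative (\<lambda>u. Re v * X u + Im v * Y u)) (at 0)"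
      by (intro derivative_intros X Y)
    then have "((\<lambda>z. frechet_derivative I (at z) v) has_derivative (\<lambda>u. Re v * X u + Im v * Y u)) (at 0)"
      by (rule has_derivative_transform_within_open[of _ _ _ _ "ball 0 r"]) (use r(1) DI in auto)
    from frechet_derivative_at[OF this] show ?thesis unfolding hessian_def q_def by metis
  qed
  then have q_pos: "0 < q v" if "v \<noteq> 0" for v
    using min that by (simp add: nondegenerate_local_min_def)
  have bl: "bounded_linear X" "bounded_linear Y"
    using X Y has_derivative_bounded_linear by auto
  then have "continuous_on (sphere 0 1) q"
    unfolding q_def[abs_def] by (intro continuous_intros linear_continuous_on) auto
  then have "\<exists>v\<in>sphere 0 1. \<forall>w\<in>sphere 0 1. q v \<le> q w"
    by (intro continuous_attains_inf) auto
  then obtain v0 where v0: "norm v0 = 1" "\<And>w. norm w = 1 \<Longrightarrow> q v0 \<le> q w" by auto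
  define m where "m = q v0"
  have "m > 0" unfolding m_def using v0(1) by (intro q_pos) auto
  have q_ge: "m * (norm z)\<^sup>2 \<le> q z" for z
  proof (cases "z = 0")
    case False
    have "X (norm z *\<^sub>R sgn z) = norm z * X (sgn z)" "Y (norm z *\<^sub>R sgn z) = norm z * Y (sgn z)"
      using bl by (simp_all only: linear_scale[OF bounded_linear.linear] real_scaleR_def)
    moreover have "norm z *\<^sub>R sgn z = z" using False by (simp add: sgn_div_norm)
    ultimately have "X z = norm z * X (sgn z)" "Y z = norm z * Y (sgn z)" by simp_all
    moreover have "Re z = norm z * Re (sgn z)" "Im z = norm z * Im (sgn z)"
      using False by (simp_all add: sgn_div_norm)
    ultimately have "q z = (norm z)\<^sup>2 * q (sgn z)"
      unfolding q_def by (simp only: power2_eq_square) (simp add: algebra_simps)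
    moreover have "m \<le> q (sgn z)" unfolding m_def using False by (intro v0(2)) (simp add: norm_sgn)
    ultimately show ?thesis by (simp add: mult.commute[of m] mult_left_mono)
  qed (simp add: q_def)
  \<comment> \<open>Each of the two errors costs at most a quarter of m |z|^2, so half of the lower
    bound survives.\<close>
  obtain d1 where d1: "d1 > 0" "\<And>z. norm z < d1 \<Longrightarrow> \<bar>gx z - X z\<bar> \<le> m / 4 * norm z"
    using X[unfolded has_derivative_at_alt] \<open>m > 0\<close> g0 by (auto dest!: spec[of _ "m / 4"])
  obtain d2 where d2: "d2 > 0" "\<And>z. norm z < d2 \<Longrightarrow> \<bar>gy z - Y z\<bar> \<le> m / 4 * norm z"
    using Y[unfolded has_derivative_at_alt] \<open>m > 0\<close> g0 by (auto dest!: spec[of _ "m / 4"])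
  have "0 < frechet_derivative I (at z) z" if "norm z < Min {r, d1, d2}" "z \<noteq> 0" for z
  proof -
    have z: "z \<in> ball 0 r" "norm z < d1" "norm z < d2" using that by auto
    have "\<bar>Re z * (gx z - X z)\<bar> \<le> norm z * (m / 4 * norm z)" "\<bar>Im z * (gy z - Y z)\<bar> \<le> norm z * (m / 4 * norm z)"
      using mult_mono[OF abs_Re_le_cmod[of z] d1(2)[OF z(2)]] mult_mono[OF abs_Im_le_cmod[of z] d2(2)[OF z(3)]]
      by (simp_all add: abs_mult)
    moreover have "frechet_derivative I (at z) z = q z + Re z * (gx z - X z) + Im z * (gy z - Y z)"
      unfolding DI[OF z(1)] q_def by (simp add: algebra_simps)
    moreover have "0 < m * (norm z)\<^sup>2" using \<open>m > 0\<close> that by simp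
    moreover have "norm z * (m / 4 * norm z) = m * (norm z)\<^sup>2 / 4" by (simp add: power2_eq_square)
    ultimately show ?thesis using q_ge[of z] by linarith
  qed
  then show ?thesis using r d1 d2 by (intro exI[of _ "Min {r, d1, d2}"]) auto
qed

text \<open>The derivative is invertible at 0 and continuous there in operator norm, because its
  columns \<open>gx\<close> and \<open>gy\<close> are analytic.\<close>

lemma analytic_locally_injective:
  fixes f :: "complex \<Rightarrow> complex"
  assumes an: "real_analytic_at f 0" and der: "(f has_derivative (\<lambda>z. \<mu> * z)) (at 0)" "\<mu> \<noteq> 0"
  shows "\<exists>r>0. inj_on f (ball 0 r)"
proof -
  obtain gx gy r where r: "r > 0" "real_analytic_at gx 0" "real_analytic_at gy 0"
    and Df: "\<And>z. z \<in> ball 0 r \<Longrightarrow>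
      (f has_derivative (\<lambda>v. of_real (Re v) * gx z + of_real (Im v) * gy z)) (at z)"
    by (rule real_analytic_at_partials_complex[OF an]) (rule that)
  define D where "D z v = of_real (Re v) * gx z + of_real (Im v) * gy z" for z v
  have D0: "D 0 = (\<lambda>z. \<mu> * z)"
    using has_derivative_unique[OF Df[of 0] der(1)] r(1) by (simp add: D_def[abs_def])
  show ?thesis
  proof (rule has_derivative_locally_injective[where a = 0 and S = "ball 0 r" and f = f
        and f' = D and g' = "\<lambda>z. z / \<mu>"])
    show "bounded_linear (\<lambda>z. z / \<mu>)" by (rule bounded_linear_divide)
    show "(\<lambda>z. z / \<mu>) \<circ> D 0 = id" using der(2) by (auto simp: D0)
    show "(f has_derivative D z) (at z)" if "z \<in> ball 0 r" for z
      using Df[OF that] by (simp add: D_def[abs_def])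
    fix e :: real assume "e > 0"
    have "isCont (\<lambda>z. norm (gx z - gx 0) + norm (gy z - gy 0)) 0"
      using real_analytic_at_isCont_complex r(2,3) by (intro continuous_intros) auto
    then obtain d where d: "d > 0" "\<And>z. dist z 0 < d \<Longrightarrow> norm (gx z - gx 0) + norm (gy z - gy 0) < e"
      using \<open>e > 0\<close> unfolding continuous_at_eps_delta by (force simp: dist_real_def)
    have "onorm (\<lambda>v. D z v - D 0 v) < e" if "dist 0 z < d" for z
    proof -
      have "norm (D z v - D 0 v) \<le> (norm (gx z - gx 0) + norm (gy z - gy 0)) * norm v" for v
      proof -
        have "D z v - D 0 v = of_real (Re v) * (gx z - gx 0) + of_real (Im v) * (gy z - gy 0)"
          by (simp add: D_def algebra_simps)
        also have "norm \<dots> \<le> \<bar>Re v\<bar> * norm (gx z - gx 0) + \<bar>Im v\<bar> * norm (gy z - gy 0)"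
          by (rule order_trans[OF norm_triangle_ineq]) (simp add: norm_mult)
        also have "\<dots> \<le> norm v * norm (gx z - gx 0) + norm v * norm (gy z - gy 0)"
          by (intro add_mono mult_right_mono abs_Re_le_cmod abs_Im_le_cmod) auto
        finally show ?thesis by (simp add: algebra_simps)
      qed
      then have "onorm (\<lambda>v. D z v - D 0 v) \<le> norm (gx z - gx 0) + norm (gy z - gy 0)"
        by (intro onorm_bound) auto
      also have "\<dots> < e" using d(2)[of z] that by (simp add: dist_commute)
      finally show ?thesis .
    qed
    then show "\<exists>d>0. \<forall>x. dist 0 x < d \<longrightarrow> onorm (\<lambda>v. D x v - D 0 v) < e" using d(1) by blast
  next
    fix r' :: real assume "0 < r'" "ball 0 r' \<subseteq> ball 0 r" "inj_on f (ball 0 r')"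
    then show ?thesis by blast
  qed (use r in auto)
qed

text \<open>\<rho> is fixed before \<open>C\<close>: analyticity and radial growth concern the whole
  ball, and \<open>f\<close> must map the disc into that ball before invariance of \<open>I\<close>
  can be used. The remaining smallness conditions concern the disc only, which is forced into a ball
  of radius \<open>e\<close>.\<close>

lemma elliptic_integral_exists:
  assumes U: "open U" "0 \<in> U" and f: "real_analytic_on f U" "elliptic_fixed_point f \<omega>" "\<omega> \<notin> \<rat>"
    and I: "real_analytic_on I U" "first_integral_on f U I" "nondegenerate_local_min I 0"
    and V: "open V" "0 \<in> V" "V \<subseteq> U"
  obtains \<rho> C where "elliptic_integral I \<rho> f C \<omega>" "ball 0 \<rho> \<subseteq> V"
proof -
  have f0: "f 0 = 0" and der0: "(f has_derivative (\<lambda>z. cis (2 * pi * \<omega>) * z)) (at 0)"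
    using f(2) by (auto simp: elliptic_fixed_point_def)
  have an: "real_analytic_at f z" "real_analytic_at I z" if "z \<in> U" for z
    using f(1) I(1) that by (auto simp: real_analytic_on_def)
  obtain R where R: "R > 0" "ball 0 R \<subseteq> V" using V openE by blast
  obtain r1 where r1: "r1 > 0" "\<And>z. norm z < r1 \<Longrightarrow> z \<noteq> 0 \<Longrightarrow> 0 < frechet_derivative I (at z) z"
    using nondegenerate_min_radial[OF an(2)[OF U(2)] I(3)] by blast
  obtain r2 where r2: "r2 > 0" "inj_on f (ball 0 r2)"
    using analytic_locally_injective[OF an(1)[OF U(2)] der0] by auto
  \<comment> \<open>Differentiability at 0 with tolerance 1/2; any tolerance below 1 keeps the
    quotient of \<open>f z\<close> by the rotated point in the right half-plane.\<close>
  obtain r3 where r3: "r3 > 0" "\<And>z. norm z < r3 \<Longrightarrow> norm (f z - cis (2 * pi * \<omega>) * z) \<le> 1 / 2 * norm z"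
    using conjunct2[OF der0[unfolded has_derivative_at_alt], rule_format, of "1 / 2"] f0 by auto
  define \<rho> where "\<rho> = min R r1"
  have \<rho>: "\<rho> > 0" "ball 0 \<rho> \<subseteq> V" "ball 0 \<rho> \<subseteq> U" "\<rho> \<le> r1" using R r1 V by (auto simp: \<rho>_def)
  interpret radial_analytic I \<rho>
    by unfold_locales (use \<rho> an r1 in auto)
  have "isCont f 0" using der0 by (rule has_derivative_continuous)
  then obtain r4 where r4: "r4 > 0" "\<And>z. norm z < r4 \<Longrightarrow> norm (f z) < \<rho>"
    using \<rho>(1) f0 unfolding continuous_at_eps_delta by (metis dist_0_norm dist_commute)
  \<comment> \<open>Halving the minimum makes \<open>e\<close> strictly smaller than all four
    radii.\<close>
  define e where "e = Min {\<rho>, r2, r3, r4} / 2"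
  have e: "0 < e" "e < \<rho>" "e < r2" "e < r3" "e < r4"
    using \<rho> r2 r3 r4 by (auto simp: e_def)
  obtain C where C: "I 0 < C" "\<And>z. norm z = e \<Longrightarrow> C \<le> I z" "sublevel_disc I \<rho> C \<subseteq> ball 0 e"
    using sublevel_disc_small[OF e(1,2)] by blast
  have small: "norm z < e" if "z \<in> sublevel_disc I \<rho> C" for z using C(3) that by force
  have "elliptic_integral I \<rho> f C \<omega>"
  proof unfold_locales
    show "I 0 < C" by fact
    show "real_analytic_at f z" if "z \<in> ball 0 \<rho>" for z using an \<rho> that by blast
    show "\<exists>t. 0 < t \<and> t < \<rho> \<and> C \<le> I (of_real t * w)" if "norm w = 1" for w
      using C(2)[of "of_real e * w"] e that by (intro exI[of _ e]) (simp add: norm_mult)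
    show "norm (f z) < \<rho> \<and> I (f z) = I z" if "z \<in> sublevel_disc I \<rho> C" for z
    proof -
      have fz: "norm (f z) < \<rho>" using r4(2) small[OF that] e by simp
      then have "z \<in> U" "f z \<in> U" using small[OF that] e \<rho>(3) by (auto simp: subset_iff)
      then show ?thesis using I(2) fz by (auto simp: first_integral_on_def)
    qed
    show "norm (f z - cis (2 * pi * \<omega>) * z) < norm z" if "z \<in> sublevel_disc I \<rho> C" "z \<noteq> 0" for z
    proof -
      have "norm (f z - cis (2 * pi * \<omega>) * z) \<le> 1 / 2 * norm z" using r3(2) small[OF that(1)] e by simp
      also have "\<dots> < norm z" using that by simp
      finally show ?thesis .
    qed
    show "inj_on f (sublevel_disc I \<rho> C)"
      by (rule inj_on_subset[OF r2(2)]) (use small e in force)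
  qed (use f0 der0 f(3) in auto)
  then show ?thesis using that \<rho>(2) by blast
qed

theorem theorem3p4:
  fixes f :: "complex \<Rightarrow> complex" and I\<^sub>1 :: "complex \<Rightarrow> real"
    and U :: "complex set" and \<omega>\<^sub>0 :: real
  assumes "open U" and "0 \<in> U"
    and "real_analytic_on f U"
    and "elliptic_fixed_point f \<omega>\<^sub>0"
    and "\<omega>\<^sub>0 \<notin> \<rat>"
    and "real_analytic_on I\<^sub>1 U"
    and "first_integral_on f U I\<^sub>1"
    and "nondegenerate_local_min I\<^sub>1 0"
  shows "no_independent_integral_near_0 f I\<^sub>1 U \<and>
    (symplectic_on U f \<longrightarrow> no_independent_integral_near_0 f I\<^sub>1 U)"
proof -
  have "no_independent_integral_near_0 f I\<^sub>1 U"
    unfolding no_independent_integral_near_0_def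
  proof (intro allI impI)
    fix V assume V: "open V \<and> 0 \<in> V \<and> V \<subseteq> U"
    obtain \<rho> C where "elliptic_integral I\<^sub>1 \<rho> f C \<omega>\<^sub>0" and \<rho>: "ball 0 \<rho> \<subseteq> V"
      using elliptic_integral_exists[OF assms, of V] V by blast
    then interpret elliptic_integral I\<^sub>1 \<rho> f C \<omega>\<^sub>0 by simp
    have "A \<subseteq> V" using A_subset \<rho> by blast
    \<comment> \<open>The witness is the sublevel disc, which \<open>f\<close> maps into itself and
      which is found before any second integral or set \<open>W\<close> is given.\<close>
    then show "\<exists>U'. open U' \<and> 0 \<in> U' \<and> U' \<subseteq> V \<and>
        \<not> (\<exists>W. open W \<and> W \<noteq> {} \<and> W \<subseteq> U' - {0} \<and> has_independent_integral_on f I\<^sub>1 U' W)"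
      using open_A zero_in_A no_independent_integral by blast
  qed
  then show ?thesis by blast
qed

end
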